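(* Let $m\le N$ and $\alpha\in [0, 1]$. Suppose $\{f_\xi\}_{\xi\in \Xi}$ has chain-constrained domain of order $m$, given by chains $\{U_k^\xi\}_{\xi\in\Xi}$, $k\in[m]$, and suppose the measurability/regularity assumptions (A1)–(A5) stated in the context hold. Then \[ \mathbb{P}^N\{\mathfrak{D}(\xi^{[N]}) < 1 - \alpha\}\le \sum_{k = 0}^{m - 1} \binom{N}{k} \alpha^k (1 - \alpha)^{N - k}; \] in particular, \[ \mathbb{P}^N\{d(x^*(\xi^{[N]})) < 1 - \alpha\}\le \mathbb{P}^N\{D(\xi^{[N]}) < 1 - \alpha\}\le \sum_{k = 0}^{m - 1} \binom{N}{k} \alpha^k (1 - \alpha)^{N - k}. \] If the chains are induced by functional constraints, i.e. $U_k^\xi = \{x : c_k(x)\le \ell_k(\xi)\}$ for functions $c_k$ and random variables $\ell_k$, then assumptions (A1)–(A5) are satisfied automatically.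
   Context: Consider the stochastic program $\inf_{x\in\mathcal{X}} F(x) := \mathbb{E}[f_\xi(x)]$, where $\mathcal{X}\subseteq\mathbb{R}^n$ is non-empty, $\xi$ is a random vector on a probability space $(\Omega,\mathcal{F},\mathbb{P})$ with support $\Xi$, and each $f_\xi:\mathbb{R}^n\to\mathbb{R}\cup\{+\infty\}$ is an extended real-valued function with effective domain $\text{dom } f_\xi=\{x: f_\xi(x)<+\infty\}$. Let $\xi^{[N]}=(\xi^1,\ldots,\xi^N)$ be an i.i.d. sample of $\xi$, with product measure $\mathbb{P}^N$ (completed), and SAA function $\hat F_N(x)=\frac1N\sum_{i=1}^N f_{\xi^i}(x)$. To each sample a solution $x^*(\xi^{[N]})$ is assigned with $x^*(\xi^{[N]})\in\mathcal{X}$ and $\hat F_N(x^*(\xi^{[N]}))<+\infty$ (not necessarily optimal). Degree of feasibility of the SAA solution: $d(x^*(\xi^{[N]})) := \mathbb{P}\{\xi\in\Xi : x^*(\xi^{[N]})\in \text{dom } f_\xi\}$. Degree of feasibility of $\text{dom }\hat F_N$: $D(\xi^{[N]}) := \mathbb{P}\{\xi\in \Xi : \cap_{i = 1}^N \text{dom } f_{\xi^i}\subseteq \text{dom } f_\xi\}$. A collection of sets $\{U^\omega\}_{\omega\in I}$ is a chain if for any $\omega_1,\omega_2\in I$ either $U^{\omega_1}\subseteq U^{\omega_2}$ or $U^{\omega_1}\supseteq U^{\omega_2}$. $\{f_\xi\}$ has chain-constrained domain of order $m$ if there are $m$ chains $\{U_k^\xi\}_{\xi\in\Xi}$, $k\in[m]$,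 with $\text{dom } f_\xi=\cap_{k=1}^m U_k^\xi$ for every $\xi\in\Xi$. Define \[ \mathfrak{D}(\xi^{[N]}) := \mathbb{P}\left\{\xi\in \Xi : \cap_{i = 1}^N U_k^{\xi^i}\subseteq U_k^\xi \text{ for all } k\in [m]\right\}. \] Assumptions (A1)–(A5) (those of the paper's appendix theorem on probability on chains): each chain induces a preorder on $\Xi$ by $\omega_1\le_k\omega_2 \iff U_k^{\omega_1}\subseteq U_k^{\omega_2}$ (write $=_k$ when both hold, $<_k$ for $\le_k$ and not $=_k$); the $\sigma$-algebra is assumed to contain the sets $\{y: y=_k x\}$ and $\{y: y\le_k x\}$. (A1): $\mathfrak{D}$ is a random variable on the product space. For (A2)–(A5), form $\mathfrak{X}=\Xi\times[0,1]$ with product measure $\mathbb{P}_\lambda=\mathbb{P}\times\lambda$ ($\lambda$ Lebesgue measure on $[0,1]$) and relations $(x,s)\le_k(y,t)$ iff $x<_k y$, or $x=_k y$ and $s\le t$; on this space: for an $N$-tuple $\mathbf{x}$ let $\tilde{\mathbf{x}}$ be a permutation such that, for each $k\in[m]$, $\tilde x_k\le_k \tilde x_{k'}$ for all $k'\ge k$, and let $\delta_k(\mathbf{x})=\mathbb{P}_\lambda\{x : x<_j \tilde x_j \text{ for some } j\in[k]\}$, $S_k(x)=\mathbb{P}_\lambda\{y: y\ge_k x\}$. (A2): each $\delta_k$ is a random variable. (A3): the sets $\{x: S_k(x)=\beta\}$, $\beta\in[0,1]$, are measurable. (A4): for every measurable $Y$ with $\mathbb{P}_\lambda(Y)>0$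 and each $k$, $\sup_{x,y\in Y}\mathbb{P}_\lambda\{z\in Y: x\le_k z\le_k y\}>0$. (A5): the sets $\{\mathbf{x}: x_j=_j\tilde x_j,\ j\in[k]\}$ are measurable. *)

theory Defs
  imports "HOL-Probability.Probability"
begin

text \<open>The random vector xi is represented through its distribution: a probability
measure M whose space is the support Xi. Extended real-valued functions
f_xi : R^n -> R \<union> {+\<infinity>} are modelled as ereal-valued functions that never take
the value -\<infinity> (an explicit hypothesis of the theorem).\<close>

definition dom_f :: "('xi \<Rightarrow> 'x \<Rightarrow> ereal) \<Rightarrow> 'xi \<Rightarrow> 'x set" where
  "dom_f f \<xi> = {x. f \<xi> x < \<infinity>}"

definition SAA :: "('xi \<Rightarrow> 'x \<Rightarrow> ereal) \<Rightarrow> nat \<Rightarrow> (nat \<Rightarrow> 'xi) \<Rightarrow> 'x \<Rightarrow> ereal" where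
  "SAA f N s x = ereal (1 / real N) * (\<Sum>i<N. f (s i) x)"

definition PN :: "'a measure \<Rightarrow> nat \<Rightarrow> (nat \<Rightarrow> 'a) measure" where
  "PN M N = completion (Pi\<^sub>M {..<N} (\<lambda>_. M))"

text \<open>Outer probability (equal to the probability for measurable events); used for
events whose measurability is not guaranteed by the hypotheses.\<close>
definition outer_prob :: "'a measure \<Rightarrow> 'a set \<Rightarrow> real" where
  "outer_prob M A = Inf {measure M B | B. B \<in> sets M \<and> A \<subseteq> B}"

definition d_feas :: "'xi measure \<Rightarrow> ('xi \<Rightarrow> 'x \<Rightarrow> ereal) \<Rightarrow> 'x \<Rightarrow> real" where
  "d_feas M f x = outer_prob M {\<xi> \<in> space M. x \<in> dom_f f \<xi>}"

definition D_feas :: "'xi measure \<Rightarrow> ('xi \<Rightarrow> 'x \<Rightarrow> ereal) \<Rightarrow> nat \<Rightarrow> (nat \<Rightarrow> 'xi) \<Rightarrow> real" where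
  "D_feas M f N s = outer_prob M {\<xi> \<in> space M. (\<Inter>i<N. dom_f f (s i)) \<subseteq> dom_f f \<xi>}"

text \<open>Chains indexed by k < m (0-based version of k in [m]).\<close>
definition chain_constrained ::
  "'xi measure \<Rightarrow> ('xi \<Rightarrow> 'x \<Rightarrow> ereal) \<Rightarrow> nat \<Rightarrow> (nat \<Rightarrow> 'xi \<Rightarrow> 'x set) \<Rightarrow> bool" where
  "chain_constrained M f m U \<longleftrightarrow>
     (\<forall>k<m. \<forall>a\<in>space M. \<forall>b\<in>space M. U k a \<subseteq> U k b \<or> U k b \<subseteq> U k a) \<and>
     (\<forall>\<xi>\<in>space M. dom_f f \<xi> = (\<Inter>k<m. U k \<xi>))"

definition frakD :: "'xi measure \<Rightarrow> nat \<Rightarrow> (nat \<Rightarrow> 'xi \<Rightarrow> 'x set) \<Rightarrow> nat \<Rightarrow> (nat \<Rightarrow> 'xi) \<Rightarrow> real" where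
  "frakD M m U N s = measure M {\<xi> \<in> space M. \<forall>k<m. (\<Inter>i<N. U k (s i)) \<subseteq> U k \<xi>}"

definition sigma_contains :: "'xi measure \<Rightarrow> nat \<Rightarrow> (nat \<Rightarrow> 'xi \<Rightarrow> 'x set) \<Rightarrow> bool" where
  "sigma_contains M m U \<longleftrightarrow>
     (\<forall>k<m. \<forall>x\<in>space M. {y \<in> space M. U k y = U k x} \<in> sets M \<and>
                         {y \<in> space M. U k y \<subseteq> U k x} \<in> sets M)"

definition Pl :: "'xi measure \<Rightarrow> ('xi \<times> real) measure" where
  "Pl M = M \<Otimes>\<^sub>M restrict_space lborel {0..1::real}"

definition PlN :: "'xi measure \<Rightarrow> nat \<Rightarrow> (nat \<Rightarrow> 'xi \<times> real) measure" where
  "PlN M N = completion (Pi\<^sub>M {..<N} (\<lambda>_. Pl M))"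

definition leX :: "(nat \<Rightarrow> 'xi \<Rightarrow> 'x set) \<Rightarrow> nat \<Rightarrow> 'xi \<times> real \<Rightarrow> 'xi \<times> real \<Rightarrow> bool" where
  "leX U k p q \<longleftrightarrow> U k (fst p) \<subset> U k (fst q) \<or> (U k (fst p) = U k (fst q) \<and> snd p \<le> snd q)"

definition ltX :: "(nat \<Rightarrow> 'xi \<Rightarrow> 'x set) \<Rightarrow> nat \<Rightarrow> 'xi \<times> real \<Rightarrow> 'xi \<times> real \<Rightarrow> bool" where
  "ltX U k p q \<longleftrightarrow> leX U k p q \<and> \<not> leX U k q p"

definition eqX :: "(nat \<Rightarrow> 'xi \<Rightarrow> 'x set) \<Rightarrow> nat \<Rightarrow> 'xi \<times> real \<Rightarrow> 'xi \<times> real \<Rightarrow> bool" where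
  "eqX U k p q \<longleftrightarrow> leX U k p q \<and> leX U k q p"

definition tilde_perm ::
  "'xi measure \<Rightarrow> nat \<Rightarrow> nat \<Rightarrow> (nat \<Rightarrow> 'xi \<Rightarrow> 'x set) \<Rightarrow> ((nat \<Rightarrow> 'xi \<times> real) \<Rightarrow> nat \<Rightarrow> nat) \<Rightarrow> bool" where
  "tilde_perm M N m U \<sigma> \<longleftrightarrow>
     (\<forall>x \<in> space (PlN M N). bij_betw (\<sigma> x) {..<N} {..<N} \<and>
        (\<forall>k<m. \<forall>k'. k \<le> k' \<and> k' < N \<longrightarrow> leX U k (x (\<sigma> x k)) (x (\<sigma> x k'))))"

definition delta ::
  "'xi measure \<Rightarrow> (nat \<Rightarrow> 'xi \<Rightarrow> 'x set) \<Rightarrow> ((nat \<Rightarrow> 'xi \<times> real) \<Rightarrow> nat \<Rightarrow> nat) \<Rightarrow> nat \<Rightarrow> (nat \<Rightarrow> 'xi \<times> real) \<Rightarrow> real" where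
  "delta M U \<sigma> k x = measure (Pl M) {z \<in> space (Pl M). \<exists>j<k. ltX U j z (x (\<sigma> x j))}"

definition S_fun :: "'xi measure \<Rightarrow> (nat \<Rightarrow> 'xi \<Rightarrow> 'x set) \<Rightarrow> nat \<Rightarrow> 'xi \<times> real \<Rightarrow> real" where
  "S_fun M U k x = measure (Pl M) {y \<in> space (Pl M). leX U k x y}"

definition A1 :: "'xi measure \<Rightarrow> nat \<Rightarrow> nat \<Rightarrow> (nat \<Rightarrow> 'xi \<Rightarrow> 'x set) \<Rightarrow> bool" where
  "A1 M N m U \<longleftrightarrow> (\<lambda>s. frakD M m U N s) \<in> borel_measurable (PN M N)"

definition A2 :: "'xi measure \<Rightarrow> nat \<Rightarrow> nat \<Rightarrow> (nat \<Rightarrow> 'xi \<Rightarrow> 'x set) \<Rightarrow> ((nat \<Rightarrow> 'xi \<times> real) \<Rightarrow> nat \<Rightarrow> nat) \<Rightarrow> bool" where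
  "A2 M N m U \<sigma> \<longleftrightarrow> (\<forall>k\<in>{1..m}. delta M U \<sigma> k \<in> borel_measurable (PlN M N))"

definition A3 :: "'xi measure \<Rightarrow> nat \<Rightarrow> (nat \<Rightarrow> 'xi \<Rightarrow> 'x set) \<Rightarrow> bool" where
  "A3 M m U \<longleftrightarrow> (\<forall>k<m. \<forall>\<beta>\<in>{0..1::real}. {x \<in> space (Pl M). S_fun M U k x = \<beta>} \<in> sets (Pl M))"

definition A4 :: "'xi measure \<Rightarrow> nat \<Rightarrow> (nat \<Rightarrow> 'xi \<Rightarrow> 'x set) \<Rightarrow> bool" where
  "A4 M m U \<longleftrightarrow> (\<forall>Y \<in> sets (Pl M). measure (Pl M) Y > 0 \<longrightarrow>
     (\<forall>k<m. (SUP p\<in>Y \<times> Y. measure (Pl M) {z \<in> Y. leX U k (fst p) z \<and> leX U k z (snd p)}) > 0))"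

definition A5 :: "'xi measure \<Rightarrow> nat \<Rightarrow> nat \<Rightarrow> (nat \<Rightarrow> 'xi \<Rightarrow> 'x set) \<Rightarrow> ((nat \<Rightarrow> 'xi \<times> real) \<Rightarrow> nat \<Rightarrow> nat) \<Rightarrow> bool" where
  "A5 M N m U \<sigma> \<longleftrightarrow> (\<forall>k\<in>{1..m}.
     {x \<in> space (PlN M N). \<forall>j<k. eqX U j (x j) (x (\<sigma> x j))} \<in> sets (PlN M N))"

end

(*
  Attaching an independent uniform label to xi breaks ties, and by (A3) and (A4) the rank functions
  S_k on Xi x [0,1] then become measurable with null level sets. The bound thus reduces to real
  functions V_0, ..., V_{m-1} with atomless laws under a finite measure Q of mass c, of arbitrary
  joint distribution: the probability that
      Q {z. for some k, V_k z < V_k (x_i) for all i} > a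
  is at most the sum over k < m of C(N,k) a^k (c-a)^(N-k).
  Induct on m. Condition on the sample point x_i that minimises V_0. The mass t = Q {V_0 < V_0 (x_i)}
  is uniform on [0,c] because V_0 is atomless, and the remaining N-1 points lie in
  {V_0 >= V_0 (x_i)}, a set of mass c-t. If t > a this contributes (c-t)^(N-1); otherwise the
  induction hypothesis applies to Q restricted to that set with threshold a-t. Integrating over t
  and summing over i turns the bound for (m, N-1) into the bound for (m+1, N).
*)
theory Submission
  imports Defs
begin

text \<open>The induction runs over unnormalised measures because restricting \<open>Q\<close> and
  lowering the threshold by the same t leaves the difference (c - t) - (a - t) = c - a fixed.
  Normalising by c - t would destroy this; as it is, only the powers (a - t)^k depend on t and the
  integral is elementary.

  The ranks are built from an order, and (A3) controls only their level sets. That suffices because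
  a superlevel set of a monotone rank is a countable union of order rays, up to one level set.

  Two obstacles arise when (A1)-(A5) are to be derived for functional constraints. Inclusion of two
  sublevel sets quantifies over uncountably many points, so it has to be tested on countably many
  values of the constraint function. And the sorting permutation \<sigma> is an arbitrary selection,
  possibly not measurable; outside the null set of tied labels its relevant values are forced, and
  the completed measure absorbs the rest.\<close>

section \<open>Auxiliary facts on real functions and product measures\<close>

text \<open>Probability integral transform. Atomlessness makes the distribution function of
  \<open>V\<close> continuous, so strict and weak inequality have the same mass, \<open>T\<close> is
  that function composed with \<open>V\<close>, and comparing the masses of open half-lines
  identifies its law.\<close>

lemma (in finite_measure) distr_measure_less:
  fixes V :: "'a \<Rightarrow> real"
  assumes V [measurable]: "V \<in> borel_measurable M"
    and atomless: "\<And>v. measure M {z \<in> space M. V z = v} = 0"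
  shows "distr M borel (\<lambda>y. measure M {z \<in> space M. V z < V y}) =
    density lborel (indicator {0..measure M (space M)})" (is "?L = ?R")
proof -
  define c where "c = measure M (space M)"
  define T where "T y = measure M {z \<in> space M. V z < V y}" for y
  define D where "D = distr M borel V"
  have D_eq: "measure D A = measure M {z \<in> space M. V z \<in> A}" if "A \<in> sets borel" for A
    using that unfolding D_def by (subst measure_distr) (auto simp: vimage_def Int_def conj_commute)
  interpret D: finite_borel_measure D
    unfolding finite_borel_measure_def finite_borel_measure_axioms_def D_def
    by (simp add: finite_measure_distr)
  have cont: "isCont (cdf D) v" for v
    unfolding D.isCont_cdf using atomless[of v] by (simp add: D_eq)
  have Dc: "measure D (space D) = c"
    by (simp add: D_def measure_distr c_def)
  have F_le: "cdf D v = measure M {z \<in> space M. V z \<le> v}" for v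
    by (simp add: cdf_def D_eq)
  have T_F: "T y = cdf D (V y)" for y
  proof -
    have "measure M {z \<in> space M. V z \<le> V y} =
        measure M ({z \<in> space M. V z < V y} \<union> {z \<in> space M. V z = V y})"
      by (rule arg_cong[where f = "measure M"]) auto
    also have "\<dots> = T y + measure M {z \<in> space M. V z = V y}"
      unfolding T_def by (rule finite_measure_Union) auto
    finally show ?thesis using atomless[of "V y"] by (simp add: F_le)
  qed
  have "cdf D \<in> borel_measurable borel"
    using cont by (intro borel_measurable_continuous_onI) (simp add: continuous_at_imp_continuous_on)
  then have T_meas [measurable]: "T \<in> borel_measurable M"
    unfolding T_F by measurable
  have tail: "measure M {y \<in> space M. u < T y} = c - u" if u: "0 \<le> u" "u < c" for u
  proof (cases "\<exists>v. cdf D v \<le> u")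
    \<comment> \<open>If the distribution function exceeds \<open>u\<close> everywhere, its limit 0
      at minus infinity forces \<open>u = 0\<close>.\<close>
    case False
    have "u \<le> 0"
    proof (rule tendsto_lowerbound[OF D.cdf_lim_at_bot])
      show "\<forall>\<^sub>F x in at_bot. u \<le> cdf D x"
        using False by (auto simp: not_le intro!: always_eventually less_imp_le)
    qed simp
    moreover have "{y \<in> space M. u < T y} = space M"
      using False by (auto simp: T_F not_le)
    ultimately show ?thesis using u by (simp add: c_def)
  next
    case True
    define W where "W = {v. cdf D v \<le> u}"
    have "\<forall>\<^sub>F x in at_top. u < cdf D x"
      using D.cdf_lim_at_top u(2) unfolding Dc by (rule order_tendstoD)
    then obtain b where b: "u < cdf D b"
      by (auto simp: eventually_at_top_linorder)
    have bdd: "bdd_above W"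
      unfolding W_def using b D.cdf_nondecreasing
      by (intro bdd_aboveI[of _ b]) (metis (no_types, lifting) linorder_not_less mem_Collect_eq order_less_imp_le order_trans)
    have ne: "W \<noteq> {}" using True by (auto simp: W_def)
    have "closed W"
      unfolding W_def using cont
      by (intro closed_Collect_le continuous_on_const) (simp add: continuous_at_imp_continuous_on)
    then have SW: "Sup W \<in> W"
      using closed_contains_Sup[OF ne bdd] by blast
    \<comment> \<open>The last point at which the distribution function is at most \<open>u\<close>.
      By continuity its value there is exactly \<open>u\<close>, so \<open>u < T y\<close> means
      \<open>v < V y\<close>.\<close>
    define v where "v = Sup W"
    have Fv: "cdf D v \<le> u" using SW by (simp add: W_def v_def)
    have above: "u < cdf D w" if "v < w" for w
      using cSup_upper[OF _ bdd, of w] that unfolding v_def W_def by (force simp: not_le[symmetric])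
    have iff: "u < cdf D w \<longleftrightarrow> v < w" for w
      using above D.cdf_nondecreasing[of w v] Fv by (meson leD le_less_linear order_trans)
    have "u \<le> cdf D v"
    proof (rule tendsto_lowerbound)
      show "(cdf D \<longlongrightarrow> cdf D v) (at_right v)"
        using D.cdf_is_right_cont[of v] by (simp add: continuous_within)
      show "\<forall>\<^sub>F x in at_right v. u \<le> cdf D x"
        using above by (auto simp: eventually_at_filter less_imp_le intro!: always_eventually)
    qed simp
    then have "cdf D v = u" using Fv by simp
    moreover have "{y \<in> space M. u < T y} = space M - {y \<in> space M. V y \<le> v}"
      by (auto simp: T_F iff)
    ultimately show ?thesis
      by (simp add: finite_measure_compl F_le c_def)
  qed
  have T_bounds: "0 \<le> T y" "T y \<le> c" for y
    unfolding T_def c_def by (auto intro: finite_measure_mono)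
  have c0: "0 \<le> c" by (simp add: c_def)
  have "distr M borel T = density lborel (indicator {0..c})"
  proof (rule measure_eqI_lessThan)
    show "emeasure (distr M borel T) {x<..} < \<infinity>" for x
      using finite_measure.emeasure_finite[OF finite_measure_distr[OF T_meas], of "{x<..}"]
      by (simp add: less_top)
    show "emeasure (distr M borel T) {x<..} = emeasure (density lborel (indicator {0..c})) {x<..}" for x
    proof -
      have L: "emeasure (distr M borel T) {x<..} = ennreal (measure M {y \<in> space M. x < T y})"
        by (subst emeasure_distr) (auto simp: emeasure_eq_measure vimage_def Int_def conj_commute)
      have R: "emeasure (density lborel (indicator {0..c})) {x<..} = emeasure lborel ({0..c} \<inter> {x<..})"
        by (subst emeasure_density) (simp_all add: indicator_inter_arith[symmetric] del: indicator_inter_arith)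
      consider "x < 0" | "0 \<le> x" "x < c" | "c \<le> x" by linarith
      then show ?thesis
      proof cases
        case 1
        then have "{y \<in> space M. x < T y} = space M" "{0..c} \<inter> {x<..} = {0..c}"
          using T_bounds by (auto intro: less_le_trans)
        then show ?thesis using c0 by (simp only: L R) (simp add: c_def)
      next
        case 2
        then have "{0..c} \<inter> {x<..} = {x<..c}" by auto
        then show ?thesis using 2 by (simp add: L R tail)
      next
        case 3
        then have "{y \<in> space M. x < T y} = {}" "{0..c} \<inter> {x<..} = {}"
          using T_bounds by (auto simp: not_less intro: order_trans)
        then show ?thesis by (simp only: L R) simp
      qed
    qed
  qed simp_all
  then show ?thesis by (simp add: T_def[abs_def] c_def)
qed

text \<open>Both sides agree on boxes. This is how a bound for samples from the restricted measure
  becomes a bound for samples from \<open>Q\<close> that all fall into \<open>A\<close>; restricting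
  by a density keeps the underlying space, so the same sample functions serve both products.\<close>

lemma PiM_density_indicator:
  assumes Q: "sigma_finite_measure Q" and I: "finite I" and A [measurable]: "A \<in> sets Q"
    and E [measurable]: "E \<in> sets (PiM I (\<lambda>_. Q))"
  shows "emeasure (PiM I (\<lambda>_. density Q (indicator A))) E = emeasure (PiM I (\<lambda>_. Q)) (E \<inter> (PiE I (\<lambda>_. A)))"
proof -
  interpret Q: sigma_finite_measure Q by fact
  interpret P: product_sigma_finite "\<lambda>_. Q" by standard
  have "sigma_finite_measure (density Q (indicator A))"
    by (subst Q.sigma_finite_iff_density_finite) (auto simp: indicator_def)
  then interpret P': product_sigma_finite "\<lambda>_. density Q (indicator A)"
    by (simp add: product_sigma_finite_def)
  have S: "sets (PiM I (\<lambda>_. density Q (indicator A))) = sets (PiM I (\<lambda>_. Q))"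
    by (rule sets_PiM_cong) auto
  have [measurable]: "PiE I (\<lambda>_. A) \<in> sets (PiM I (\<lambda>_. Q))"
    using I by (intro sets_PiM_I_finite) auto
  have "density (PiM I (\<lambda>_. Q)) (indicator (PiE I (\<lambda>_. A))) = PiM I (\<lambda>_. density Q (indicator A))"
  proof (rule P'.PiM_eqI[OF I])
    fix B assume "\<And>i. i \<in> I \<Longrightarrow> B i \<in> sets (density Q (indicator A))"
    then have B [measurable]: "\<And>i. i \<in> I \<Longrightarrow> B i \<in> sets Q" by simp
    have "emeasure (density (PiM I (\<lambda>_. Q)) (indicator (PiE I (\<lambda>_. A)))) (PiE I B)
        = emeasure (PiM I (\<lambda>_. Q)) (PiE I (\<lambda>_. A) \<inter> PiE I B)"
      using I B by (subst emeasure_restricted) (auto intro!: sets_PiM_I_finite)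
    also have "PiE I (\<lambda>_. A) \<inter> PiE I B = PiE I (\<lambda>i. A \<inter> B i)" by (simp add: PiE_Int)
    also have "emeasure (PiM I (\<lambda>_. Q)) \<dots> = (\<Prod>i\<in>I. emeasure Q (A \<inter> B i))"
      using I by (intro P.emeasure_PiM) auto
    also have "\<dots> = (\<Prod>i\<in>I. emeasure (density Q (indicator A)) (B i))"
      by (intro prod.cong refl) (simp add: emeasure_restricted)
    finally show "emeasure (density (PiM I (\<lambda>_. Q)) (indicator (PiE I (\<lambda>_. A)))) (PiE I B)
        = (\<Prod>i\<in>I. emeasure (density Q (indicator A)) (B i))" .
  qed (simp add: S)
  then show ?thesis
    by (metis (no_types, lifting) emeasure_restricted Int_commute E \<open>PiE I (\<lambda>_. A) \<in> sets (PiM I (\<lambda>_. Q))\<close>)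
qed

text \<open>Meant for \<open>C\<close> the range of a constraint function: one sublevel set fails to
  lie in another exactly when some value of the function falls into a half-open interval between the
  two levels, and this must be decided by countably many values.\<close>

lemma countable_hitting_set:
  fixes C :: "real set"
  obtains C' where "countable C'" "C' \<subseteq> C"
    "\<And>s t. C \<inter> {s<..t} \<noteq> {} \<Longrightarrow> C' \<inter> {s<..t} \<noteq> {}"
proof -
  \<comment> \<open>A dense subset of \<open>C\<close> misses \<open>{s<..t}\<close> only if \<open>t\<close> is isolated in \<open>C\<close> from the left.\<close>
  define L where "L = (\<Union>q\<in>\<rat>. {t \<in> C. q < t \<and> C \<inter> {q<..<t} = {}})"
  define D where "D = (\<lambda>(p, q). SOME c. c \<in> C \<inter> {p<..<q}) ` {(p, q). p \<in> \<rat> \<and> q \<in> \<rat> \<and> C \<inter> {p<..<q} \<noteq> {}}"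
  have D: "(SOME c. c \<in> C \<inter> {p<..<q}) \<in> C \<inter> {p<..<q}" if "C \<inter> {p<..<q} \<noteq> {}" for p q
    using that by (metis ex_in_conv someI_ex)
  \<comment> \<open>For fixed \<open>q\<close> at most one \<open>t\<close> qualifies: the smaller
    of two would lie between \<open>q\<close> and the larger.\<close>
  have "countable {t \<in> C. q < t \<and> C \<inter> {q<..<t} = {}}" for q
  proof (cases "{t \<in> C. q < t \<and> C \<inter> {q<..<t} = {}} = {}")
    case False
    then obtain t where t: "t \<in> C" "q < t" "C \<inter> {q<..<t} = {}" by blast
    have "{t \<in> C. q < t \<and> C \<inter> {q<..<t} = {}} \<subseteq> {t}"
    proof safe
      fix t' assume t': "t' \<in> C" "q < t'" "C \<inter> {q<..<t'} = {}"
      show "t' = t" using t t' by (cases t' t rule: linorder_cases) auto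
    qed
    then show ?thesis by (rule countable_subset) simp
  qed (simp del: Collect_empty_eq)
  then have "countable L" unfolding L_def by (intro countable_UN countable_rat) auto
  moreover have "countable D"
    unfolding D_def
    by (intro countable_image countable_subset[OF _ countable_SIGMA[OF countable_rat, of "\<lambda>_. \<rat>"]]) (auto intro: countable_rat)
  moreover have "L \<subseteq> C" by (auto simp: L_def)
  moreover have "D \<subseteq> C"
  proof
    fix c assume "c \<in> D"
    then obtain p q where "C \<inter> {p<..<q} \<noteq> {}" "c = (SOME c. c \<in> C \<inter> {p<..<q})"
      unfolding D_def by (auto simp del: Int_iff greaterThanLessThan_iff)
    then show "c \<in> C" using D[of p q] by (metis IntD1)
  qed
  moreover have "(L \<union> D) \<inter> {s<..t} \<noteq> {}" if "C \<inter> {s<..t} \<noteq> {}" for s t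
  proof -
    obtain c where c: "c \<in> C" "s < c" "c \<le> t" using \<open>C \<inter> {s<..t} \<noteq> {}\<close> by auto
    obtain p where p: "p \<in> \<rat>" "s < p" "p < c" using Rats_dense_in_real[OF c(2)] by auto
    show ?thesis
    proof (cases "C \<inter> {p<..<c} = {}")
      case True
      then have "c \<in> L" using c p by (auto simp: L_def)
      then show ?thesis using c by auto
    next
      case False
      then obtain d where d: "d \<in> C" "p < d" "d < c" by auto
      obtain q where q: "q \<in> \<rat>" "d < q" "q < c" using Rats_dense_in_real[OF d(3)] by auto
      have ne: "C \<inter> {p<..<q} \<noteq> {}" using d q by auto
      define e where "e = (SOME c. c \<in> C \<inter> {p<..<q})"
      have "e \<in> D" unfolding D_def e_def using ne p q by (intro image_eqI[where x = "(p, q)"]) auto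
      moreover have "e \<in> {s<..t}" using D[OF ne] p q c unfolding e_def[symmetric] by auto
      ultimately show ?thesis by auto
    qed
  qed
  ultimately show thesis by (intro that[of "L \<union> D"]) auto
qed

section \<open>The exceedance bound\<close>

lemma (in sigma_finite_measure) borel_measurable_measure_Collect:
  assumes P: "Measurable.pred (N \<Otimes>\<^sub>M M) (\<lambda>(x, z). P x z)"
  shows "(\<lambda>x. measure M {z \<in> space M. P x z}) \<in> borel_measurable N"
proof -
  have "(\<lambda>x. emeasure M {z \<in> space M. P x z}) \<in> borel_measurable N"
  proof (rule measurable_emeasure)
    have "Measurable.pred (N \<Otimes>\<^sub>M M) (\<lambda>x. P (fst x) (snd x))"
      using P by (simp add: split_beta')
    moreover have "{x \<in> space (N \<Otimes>\<^sub>M M). snd x \<in> {z \<in> space M. P (fst x) z}} =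
        {x \<in> space (N \<Otimes>\<^sub>M M). P (fst x) (snd x)}"
      by (auto simp: space_pair_measure)
    ultimately show "{x \<in> space (N \<Otimes>\<^sub>M M). snd x \<in> {z \<in> space M. P (fst x) z}} \<in> sets (N \<Otimes>\<^sub>M M)"
      by (simp add: pred_def)
  qed auto
  then show ?thesis unfolding measure_def by measurable
qed

lemma sets_exceed:
  fixes V :: "nat \<Rightarrow> 'a \<Rightarrow> real"
  assumes Q: "finite_measure Q" and I: "finite I"
    and V: "\<And>k. k < m \<Longrightarrow> V k \<in> borel_measurable Q"
  shows "{x \<in> space (PiM I (\<lambda>_. Q)). a < measure Q {z \<in> space Q. \<exists>k<m. \<forall>i\<in>I. V k z < V k (x i)}}
    \<in> sets (PiM I (\<lambda>_. Q))"
proof -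
  interpret finite_measure Q by fact
  have "Measurable.pred (PiM I (\<lambda>_. Q) \<Otimes>\<^sub>M Q) (\<lambda>(x, z). \<exists>k\<in>{..<m}. \<forall>i\<in>I. V k z < V k (x i))"
    unfolding split_beta'
  proof (intro pred_intros_finite I finite_lessThan)
    fix k i assume "k \<in> {..<m}" and i: "i \<in> I"
    then have [measurable]: "V k \<in> borel_measurable Q" using V by simp
    show "Measurable.pred (PiM I (\<lambda>_. Q) \<Otimes>\<^sub>M Q) (\<lambda>p. V k (snd p) < V k (fst p i))"
      using i by measurable
  qed
  then have [measurable]: "(\<lambda>x. measure Q {z \<in> space Q. \<exists>k\<in>{..<m}. \<forall>i\<in>I. V k z < V k (x i)})
      \<in> borel_measurable (PiM I (\<lambda>_. Q))"
    by (rule borel_measurable_measure_Collect)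
  have "{x \<in> space (PiM I (\<lambda>_. Q)). a < measure Q {z \<in> space Q. \<exists>k\<in>{..<m}. \<forall>i\<in>I. V k z < V k (x i)}}
    \<in> sets (PiM I (\<lambda>_. Q))"
    by measurable
  then show ?thesis by (simp only: Bex_def lessThan_iff)
qed

text \<open>Integrating (a - u)^k over [0, a] gives a^(k+1) / (k+1), and the factor n + 1 turns
  C(n,k) / (k+1) into C(n+1,k+1), which shifts the index by one. The part of the integral over
  [a, c] yields (c - a)^(n+1), the missing summand for k = 0.\<close>

lemma nn_integral_binomial_recursion:
  fixes a c :: real
  assumes a: "0 \<le> a" "a \<le> c"
  shows "ennreal (real (Suc n)) * (\<integral>\<^sup>+u. ennreal (if u \<le> a then \<Sum>k<m. real (n choose k) * (a - u) ^ k * (c - a) ^ (n - k)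
              else (c - u) ^ n) * indicator {0..c} u \<partial>lborel)
    \<le> ennreal (\<Sum>k<Suc m. real (Suc n choose k) * a ^ k * (c - a) ^ (Suc n - k))"
proof -
  define f where "f u = (\<Sum>k<m. real (n choose k) * (a - u) ^ k * (c - a) ^ (n - k))" for u
  define F where "F u = - (\<Sum>k<m. real (n choose k) * (c - a) ^ (n - k) * ((a - u) ^ Suc k / real (Suc k)))" for u
  define G where "G u = - ((c - u) ^ Suc n / real (Suc n))" for u
  have f_meas [measurable]: "f \<in> borel_measurable borel" unfolding f_def by measurable
  have f_nonneg: "0 \<le> f u" if "u \<le> a" for u
    unfolding f_def using that a by (intro sum_nonneg mult_nonneg_nonneg) auto
  have D: "((\<lambda>u. (b - u) ^ Suc k / real (Suc k)) has_real_derivative - ((b - u) ^ k)) (at u)" for b u and k :: nat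
  proof -
    have "((\<lambda>u. (b - u) ^ Suc k) has_real_derivative real (Suc k) * (b - u) ^ k * (- 1)) (at u)"
      by (rule derivative_eq_intros refl | simp del: of_nat_Suc power_Suc)+
    from DERIV_cdivide[OF this, of "real (Suc k)"] show ?thesis by (simp del: of_nat_Suc power_Suc)
  qed
  have dG: "(G has_real_derivative (c - u) ^ n) (at u)" for u
    unfolding G_def using DERIV_minus[OF D[of c n u]] by simp
  have dF: "(F has_real_derivative f u) (at u)" for u
  proof -
    have "(F has_real_derivative - (\<Sum>k<m. real (n choose k) * (c - a) ^ (n - k) * - ((a - u) ^ k))) (at u)"
      unfolding F_def by (intro DERIV_minus DERIV_sum DERIV_cmult D)
    then show ?thesis by (simp add: f_def sum_negf mult_ac)
  qed
  have 1: "(\<integral>\<^sup>+u. ennreal (f u) * indicator {0..a} u \<partial>lborel) = ennreal (F a - F 0)"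
    using a by (intro nn_integral_FTC_Icc dF f_nonneg) (auto intro: f_meas)
  have 2: "(\<integral>\<^sup>+u. ennreal ((c - u) ^ n) * indicator {a..c} u \<partial>lborel) = ennreal (G c - G a)"
    using a by (intro nn_integral_FTC_Icc dG) auto
  have "(\<integral>\<^sup>+u. ennreal (if u \<le> a then f u else (c - u) ^ n) * indicator {0..c} u \<partial>lborel)
    \<le> (\<integral>\<^sup>+u. ennreal (f u) * indicator {0..a} u + ennreal ((c - u) ^ n) * indicator {a..c} u \<partial>lborel)"
    \<comment> \<open>Only an inequality holds pointwise: \<open>u = a\<close> belongs to both
      intervals and is counted twice.\<close>
    by (intro nn_integral_mono) (auto simp: indicator_def)
  also have "\<dots> = ennreal (F a - F 0) + ennreal (G c - G a)"
    by (subst nn_integral_add) (simp_all add: 1 2)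
  also have "\<dots> = ennreal ((F a - F 0) + (G c - G a))"
  proof (rule ennreal_plus[symmetric])
    show "0 \<le> F a - F 0"
      using a by (auto simp: F_def intro!: sum_nonneg mult_nonneg_nonneg divide_nonneg_nonneg)
    show "0 \<le> G c - G a"
      using a by (auto simp: G_def)
  qed
  finally have "ennreal (real (Suc n)) * (\<integral>\<^sup>+u. ennreal (if u \<le> a then f u else (c - u) ^ n) * indicator {0..c} u \<partial>lborel)
      \<le> ennreal (real (Suc n)) * ennreal ((F a - F 0) + (G c - G a))"
    by (rule mult_left_mono) simp
  also have "\<dots> = ennreal (real (Suc n) * ((F a - F 0) + (G c - G a)))"
    by (rule ennreal_mult'[symmetric]) simp
  also have "real (Suc n) * ((F a - F 0) + (G c - G a)) =
      (\<Sum>k<Suc m. real (Suc n choose k) * a ^ k * (c - a) ^ (Suc n - k))"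
  proof -
    have F: "F a - F 0 = (\<Sum>k<m. real (n choose k) * (c - a) ^ (n - k) * (a ^ Suc k / real (Suc k)))"
      by (simp add: F_def)
    have S: "real (Suc n) * (\<Sum>k<m. real (n choose k) * (c - a) ^ (n - k) * (a ^ Suc k / real (Suc k)))
       = (\<Sum>k<m. real (Suc n choose Suc k) * a ^ Suc k * (c - a) ^ (n - k))"
      unfolding sum_distrib_left
    proof (intro sum.cong refl)
      fix k
      have "real (Suc n) * real (n choose k) = real (Suc k) * real (Suc n choose Suc k)"
        by (metis Suc_times_binomial of_nat_mult)
      then have "real (Suc n choose Suc k) = real (Suc n) * real (n choose k) / real (Suc k)"
        by (simp add: field_simps del: of_nat_Suc binomial_Suc_Suc)
      then show "real (Suc n) * (real (n choose k) * (c - a) ^ (n - k) * (a ^ Suc k / real (Suc k))) =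
          real (Suc n choose Suc k) * a ^ Suc k * (c - a) ^ (n - k)"
        by (simp del: of_nat_Suc binomial_Suc_Suc power_Suc)
    qed
    have G: "real (Suc n) * (G c - G a) = (c - a) ^ Suc n"
      by (simp add: G_def del: of_nat_Suc)
    show ?thesis
      unfolding distrib_left F S G sum.lessThan_Suc_shift diff_Suc_Suc by simp
  qed
  finally show ?thesis unfolding f_def .
qed

lemma measure_density_indicator:
  assumes "A \<in> sets Q" "B \<in> sets Q"
  shows "measure (density Q (indicator A)) B = measure Q (A \<inter> B)"
  using assms by (simp add: measure_def emeasure_restricted)

text \<open>The inner integral of the induction step: \<open>y\<close> is the sample point minimising \<open>V 0\<close>, and
  the premise \<open>IH\<close> is the induction hypothesis, applied to \<open>Q\<close> restricted to
  \<open>{z. V 0 y \<le> V 0 z}\<close> with threshold \<open>a - t\<close>.\<close>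

lemma conditional_exceedance:
  fixes V :: "nat \<Rightarrow> 'a \<Rightarrow> real" and J :: "'i set"
  assumes Q: "finite_measure Q" and J: "finite J" and i: "i \<notin> J" and "m \<le> card J"
    and V: "\<And>k. k < Suc m \<Longrightarrow> V k \<in> borel_measurable Q"
    and atomless: "\<And>k v. k < Suc m \<Longrightarrow> measure Q {z \<in> space Q. V k z = v} = 0"
    and a: "0 \<le> a" "a \<le> measure Q (space Q)" and y: "y \<in> space Q"
    and IH: "\<And>Q' V' a'. finite_measure Q' \<Longrightarrow> (\<And>k. k < m \<Longrightarrow> V' k \<in> borel_measurable Q') \<Longrightarrow>
      (\<And>k v. k < m \<Longrightarrow> measure Q' {z \<in> space Q'. V' k z = v} = 0) \<Longrightarrow> 0 \<le> a' \<Longrightarrow>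
      a' \<le> measure Q' (space Q') \<Longrightarrow>
      emeasure (PiM J (\<lambda>_. Q')) {x \<in> space (PiM J (\<lambda>_. Q')).
        a' < measure Q' {z \<in> space Q'. \<exists>k<m. \<forall>j\<in>J. V' k z < (V' k :: 'a \<Rightarrow> real) (x j)}}
      \<le> ennreal (\<Sum>k<m. real (card J choose k) * a' ^ k * (measure Q' (space Q') - a') ^ (card J - k))"
  defines "t \<equiv> measure Q {z \<in> space Q. V 0 z < V 0 y}" and "c \<equiv> measure Q (space Q)"
  shows "emeasure (PiM J (\<lambda>_. Q)) {x \<in> space (PiM J (\<lambda>_. Q)). (\<forall>j\<in>J. V 0 y \<le> V 0 (x j)) \<and>
      a < measure Q {z \<in> space Q. \<exists>k<Suc m. \<forall>j\<in>insert i J. V k z < V k ((x(i := y)) j)}}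
    \<le> ennreal (if t \<le> a then \<Sum>k<m. real (card J choose k) * (a - t) ^ k * (c - a) ^ (card J - k)
       else (c - t) ^ card J)" (is "emeasure ?P ?E \<le> _")
proof -
  interpret finite_measure Q by fact
  interpret P: product_sigma_finite "\<lambda>_. Q" by standard
  have [measurable]: "V 0 \<in> borel_measurable Q" using V by simp
  define A where "A = {z \<in> space Q. V 0 y \<le> V 0 z}"
  have A [measurable]: "A \<in> sets Q" unfolding A_def by measurable
  have A_sub: "A \<subseteq> space Q" by (auto simp: A_def)
  have "space Q - A = {z \<in> space Q. V 0 z < V 0 y}" by (auto simp: A_def)
  then have mA: "measure Q A = c - t"
    using finite_measure_compl[OF A] by (simp add: t_def c_def)
  have box [measurable]: "PiE J (\<lambda>_. A) \<in> sets ?P" using J by (intro sets_PiM_I_finite) auto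
  show ?thesis
  proof (cases "t \<le> a")
    case False
    \<comment> \<open>For \<open>t > a\<close> the points below \<open>y\<close> in
      \<open>V 0\<close> already exceed the threshold, so the exceedance condition is dropped and
      only membership of all \<open>x j\<close> in \<open>A\<close> is kept.\<close>
    have "emeasure ?P ?E \<le> emeasure ?P (PiE J (\<lambda>_. A))"
      by (rule emeasure_mono[OF _ box]) (auto simp: A_def space_PiM PiE_iff extensional_def)
    also have "\<dots> = emeasure Q A ^ card J"
      using J by (subst P.emeasure_PiM) auto
    also have "\<dots> = ennreal ((c - t) ^ card J)"
      using mA by (simp add: emeasure_eq_measure ennreal_power flip: mA)
    finally show ?thesis using False by simp
  next
    case True
    define R where "R = density Q (indicator A)"
    have R: "finite_measure R"
      unfolding R_def by (rule finite_measureI) (simp add: emeasure_restricted emeasure_eq_measure)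
    have space_R: "space R = space Q" and sets_R: "sets R = sets Q" by (simp_all add: R_def)
    have mR: "measure R B = measure Q (A \<inter> B)" if "B \<in> sets Q" for B
      unfolding R_def using that by (simp add: measure_density_indicator)
    have cR: "measure R (space R) = c - t"
      using mR[of "space Q"] A_sub mA by (simp add: space_R Int_absorb2)
    \<comment> \<open>\<open>V 0\<close> is used up by the conditioning, so the induction hypothesis
      sees the remaining functions, shifted by \<open>Suc\<close>.\<close>
    define E' where "E' = {x \<in> space (PiM J (\<lambda>_. R)).
        a - t < measure R {z \<in> space R. \<exists>k<m. \<forall>j\<in>J. V (Suc k) z < V (Suc k) (x j)}}"
    have VR: "V (Suc k) \<in> borel_measurable R" if "k < m" for k
      using V[of "Suc k"] that by (simp add: measurable_cong_sets[OF sets_R refl])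
    have E'R: "E' \<in> sets (PiM J (\<lambda>_. R))"
      unfolding E'_def using sets_exceed[OF R J, of m "\<lambda>k. V (Suc k)"] VR by simp
    have sets_PR: "sets (PiM J (\<lambda>_. R)) = sets ?P"
      by (rule sets_PiM_cong) (auto simp: sets_R)
    have E'Q: "E' \<in> sets ?P" using E'R sets_PR by simp
    have space_PR: "space (PiM J (\<lambda>_. R)) = space ?P" using sets_PR by (rule sets_eq_imp_space_eq)
    have meas_Q: "{z \<in> space Q. \<exists>k<m. \<forall>j\<in>J. V (Suc k) z < V (Suc k) (x j)} \<in> sets Q" for x
    proof -
      have "{z \<in> space Q. \<exists>k\<in>{..<m}. \<forall>j\<in>J. V (Suc k) z < V (Suc k) (x j)} \<in> sets Q"
      proof (intro sets.sets_Collect_finite_Ex sets.sets_Collect_finite_All J finite_lessThan)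
        fix k j assume "k \<in> {..<m}" "j \<in> J"
        then have [measurable]: "V (Suc k) \<in> borel_measurable Q" using V by simp
        show "{z \<in> space Q. V (Suc k) z < V (Suc k) (x j)} \<in> sets Q" by measurable
      qed
      then show ?thesis by (simp only: Bex_def lessThan_iff)
    qed
    have "?E \<subseteq> E' \<inter> PiE J (\<lambda>_. A)"
    proof
      fix x assume x: "x \<in> ?E"
      let ?B = "{z \<in> space Q. \<exists>k<m. \<forall>j\<in>J. V (Suc k) z < V (Suc k) (x j)}"
      have "a < measure Q {z \<in> space Q. \<exists>k<Suc m. \<forall>j\<in>insert i J. V k z < V k ((x(i := y)) j)}"
        using x by simp
      \<comment> \<open>An exceeding point either lies below \<open>y\<close> in \<open>V 0\<close>,
        which costs mass \<open>t\<close>, or lies in \<open>A\<close> and exceeds for a later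
        function. Dropping the comparison with \<open>y\<close> for that later function only
        enlarges the set.\<close>
      also have "\<dots> \<le> measure Q ({z \<in> space Q. V 0 z < V 0 y} \<union> (A \<inter> ?B))"
      proof (rule finite_measure_mono)
        show "{z \<in> space Q. \<exists>k<Suc m. \<forall>j\<in>insert i J. V k z < V k ((x(i := y)) j)} \<subseteq>
            {z \<in> space Q. V 0 z < V 0 y} \<union> (A \<inter> ?B)"
        proof
          fix z assume "z \<in> {z \<in> space Q. \<exists>k<Suc m. \<forall>j\<in>insert i J. V k z < V k ((x(i := y)) j)}"
          then obtain k where z: "z \<in> space Q" "k < Suc m" "\<forall>j\<in>insert i J. V k z < V k ((x(i := y)) j)"
            by blast
          show "z \<in> {z \<in> space Q. V 0 z < V 0 y} \<union> (A \<inter> ?B)"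
          proof (cases k)
            case 0
            then show ?thesis using z by auto
          next
            case (Suc l)
            have "\<forall>j\<in>J. V (Suc l) z < V (Suc l) (x j)"
              using z(3) i unfolding Suc by (metis fun_upd_other insertCI)
            then have "z \<in> ?B" using z(1,2) Suc by blast
            moreover have "z \<in> A \<or> z \<in> {z \<in> space Q. V 0 z < V 0 y}"
              using z(1) by (auto simp: A_def)
            ultimately show ?thesis by blast
          qed
        qed
      qed (use meas_Q in measurable)
      also have "\<dots> \<le> t + measure Q (A \<inter> ?B)"
        unfolding t_def by (rule measure_Un_le) (use meas_Q in measurable)
      also have "measure Q (A \<inter> ?B) = measure R ?B"
        by (rule mR[OF meas_Q, symmetric])
      finally have "a - t < measure R ?B" by simp
      then have "x \<in> E'" using x by (simp add: E'_def space_R space_PR)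
      moreover have "x \<in> PiE J (\<lambda>_. A)"
        using x by (auto simp: A_def space_PiM PiE_iff)
      ultimately show "x \<in> E' \<inter> PiE J (\<lambda>_. A)" by blast
    qed
    then have "emeasure ?P ?E \<le> emeasure ?P (E' \<inter> PiE J (\<lambda>_. A))"
      using E'Q by (intro emeasure_mono) auto
    also have "\<dots> = emeasure (PiM J (\<lambda>_. R)) E'"
      unfolding R_def
      by (rule PiM_density_indicator[symmetric]) (use J E'Q in \<open>auto intro: sigma_finite_measure_axioms\<close>)
    also have "\<dots> \<le> ennreal (\<Sum>k<m. real (card J choose k) * (a - t) ^ k * (measure R (space R) - (a - t)) ^ (card J - k))"
      unfolding E'_def
    proof (rule IH[OF R, of "\<lambda>k. V (Suc k)"])
      fix k v assume k: "k < m"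
      then have [measurable]: "V (Suc k) \<in> borel_measurable Q" using V by simp
      have "measure R {z \<in> space Q. V (Suc k) z = v} \<le> measure Q {z \<in> space Q. V (Suc k) z = v}"
        by (subst mR) (auto intro!: finite_measure_mono)
      then show "measure R {z \<in> space R. V (Suc k) z = v} = 0"
        using atomless[of "Suc k" v] k by (simp add: space_R measure_le_0_iff)
    qed (use VR True a cR in \<open>auto simp: c_def\<close>)
    finally show ?thesis using True by (simp add: cR)
  qed
qed

text \<open>The step deletes one index and restricts the measure, so \<open>Q\<close>,
  \<open>I\<close>, \<open>V\<close> and \<open>a\<close> all have to vary in the induction. Nothing
  relates the functions \<open>V k\<close> to one another; each needs only an atomless law.\<close>

lemma exceedance_bound:
  fixes V :: "nat \<Rightarrow> 'a \<Rightarrow> real" and I :: "'i set"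
  assumes "finite_measure Q" "finite I" "m \<le> card I"
    and "\<And>k. k < m \<Longrightarrow> V k \<in> borel_measurable Q"
    and "\<And>k v. k < m \<Longrightarrow> measure Q {z \<in> space Q. V k z = v} = 0"
    and "0 \<le> a" "a \<le> measure Q (space Q)"
  shows "emeasure (PiM I (\<lambda>_. Q)) {x \<in> space (PiM I (\<lambda>_. Q)).
        a < measure Q {z \<in> space Q. \<exists>k<m. \<forall>i\<in>I. V k z < V k (x i)}}
    \<le> ennreal (\<Sum>k<m. real (card I choose k) * a ^ k * (measure Q (space Q) - a) ^ (card I - k))"
  using assms
proof (induction m arbitrary: Q I V a)
  case 0
  \<comment> \<open>Without functions the exceedance set is empty, and its mass 0 is not above
    \<open>a\<close>.\<close>
  then show ?case by (simp add: leD)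
next
  case (Suc m)
  interpret finite_measure Q by fact
  interpret P: product_sigma_finite "\<lambda>_. Q" by standard
  note V = Suc.prems(4)
  have [measurable]: "V 0 \<in> borel_measurable Q" using V by simp
  define c where "c = measure Q (space Q)"
  define T where "T y = measure Q {z \<in> space Q. V 0 z < V 0 y}" for y
  have distr: "distr Q borel T = density lborel (indicator {0..c})"
    unfolding T_def c_def using Suc.prems(5)[of 0] by (intro distr_measure_less) auto
  have T [measurable]: "T \<in> borel_measurable Q"
    unfolding T_def by (rule borel_measurable_measure_Collect) measurable
  obtain n where n: "card I = Suc n" and mn: "m \<le> n" using Suc.prems(3) by (cases "card I") auto
  have "I \<noteq> {}" using n by auto
  define g where "g u = (if u \<le> a then \<Sum>k<m. real (n choose k) * (a - u) ^ k * (c - a) ^ (n - k)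
      else (c - u) ^ n)" for u
  have g [measurable]: "g \<in> borel_measurable borel" unfolding g_def by measurable
  define E where "E = {x \<in> space (PiM I (\<lambda>_. Q)).
        a < measure Q {z \<in> space Q. \<exists>k<Suc m. \<forall>i\<in>I. V k z < V k (x i)}}"
  have E [measurable]: "E \<in> sets (PiM I (\<lambda>_. Q))"
    unfolding E_def by (rule sets_exceed) (use Suc.prems in auto)
  \<comment> \<open>The events that index \<open>i\<close> attains the minimum of \<open>V 0\<close>
    may overlap in ties, but they cover \<open>E\<close>, and a union bound is enough.\<close>
  define F where "F i = {x \<in> E. \<forall>j\<in>I. V 0 (x i) \<le> V 0 (x j)}" for i
  have F [measurable]: "F i \<in> sets (PiM I (\<lambda>_. Q))" if i: "i \<in> I" for i
  proof -
    have "{x \<in> space (PiM I (\<lambda>_. Q)). \<forall>j\<in>I. V 0 (x i) \<le> V 0 (x j)} \<in> sets (PiM I (\<lambda>_. Q))"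
      by (intro sets.sets_Collect_finite_All \<open>finite I\<close>) (use i in measurable)
    moreover have "F i = E \<inter> {x \<in> space (PiM I (\<lambda>_. Q)). \<forall>j\<in>I. V 0 (x i) \<le> V 0 (x j)}"
      by (auto simp: F_def E_def)
    ultimately show ?thesis using E by simp
  qed
  have F_le: "emeasure (PiM I (\<lambda>_. Q)) (F i) \<le> (\<integral>\<^sup>+u. ennreal (g u) * indicator {0..c} u \<partial>lborel)"
    if i: "i \<in> I" for i
  proof -
    define J where "J = I - {i}"
    have J: "finite J" "i \<notin> J" "I = insert i J" "card J = n"
      using i \<open>finite I\<close> n by (auto simp: J_def)
    have mJ: "m \<le> card J" using J(4) mn by simp
    have "emeasure (PiM I (\<lambda>_. Q)) (F i) = (\<integral>\<^sup>+x. indicator (F i) x \<partial>PiM (insert i J) (\<lambda>_. Q))"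
      using F[OF i] by (simp add: J(3))
    also have "\<dots> = (\<integral>\<^sup>+y. (\<integral>\<^sup>+x. indicator (F i) (x(i := y)) \<partial>PiM J (\<lambda>_. Q)) \<partial>Q)"
      \<comment> \<open>Fubini with the minimising coordinate outermost: for fixed \<open>y\<close>
        the inner event concerns only the coordinates in \<open>J\<close>.\<close>
      using F[OF i] J by (intro P.product_nn_integral_insert_rev) auto
    also have "\<dots> \<le> (\<integral>\<^sup>+y. ennreal (g (T y)) \<partial>Q)"
    proof (rule nn_integral_mono)
      fix y assume y: "y \<in> space Q"
      let ?X = "{x \<in> space (PiM J (\<lambda>_. Q)). (\<forall>j\<in>J. V 0 y \<le> V 0 (x j)) \<and>
          a < measure Q {z \<in> space Q. \<exists>k<Suc m. \<forall>j\<in>insert i J. V k z < V k ((x(i := y)) j)}}"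
      have upd [measurable]: "(\<lambda>x. x(i := y)) \<in> measurable (PiM J (\<lambda>_. Q)) (PiM I (\<lambda>_. Q))"
        unfolding J(3) by (rule measurable_fun_upd[where J = J]) (use y in auto)
      have X: "?X = (\<lambda>x. x(i := y)) -` F i \<inter> space (PiM J (\<lambda>_. Q))"
        using measurable_space[OF upd] J(2) by (auto simp: F_def E_def J(3))
      have "(\<integral>\<^sup>+x. indicator (F i) (x(i := y)) \<partial>PiM J (\<lambda>_. Q)) = (\<integral>\<^sup>+x. indicator ?X x \<partial>PiM J (\<lambda>_. Q))"
        unfolding X by (rule nn_integral_cong) (simp add: indicator_def)
      also have "\<dots> = emeasure (PiM J (\<lambda>_. Q)) ?X"
        by (rule nn_integral_indicator) (unfold X, rule measurable_sets[OF upd F[OF i]])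
      also have "\<dots> \<le> ennreal (g (T y))"
        unfolding g_def T_def c_def J(4)[symmetric]
        by (rule conditional_exceedance[OF Suc.prems(1) J(1,2) mJ Suc.prems(4-7) y])
          (assumption | rule Suc.IH[OF _ J(1) mJ])+
      finally show "(\<integral>\<^sup>+x. indicator (F i) (x(i := y)) \<partial>PiM J (\<lambda>_. Q)) \<le> ennreal (g (T y))" .
    qed
    also have "\<dots> = (\<integral>\<^sup>+u. ennreal (g u) \<partial>distr Q borel T)"
      \<comment> \<open>The inner bound depends on \<open>y\<close> only through \<open>T y\<close>,
        whose law is Lebesgue measure on [0, c].\<close>
      by (subst nn_integral_distr) auto
    also have "\<dots> = (\<integral>\<^sup>+u. ennreal (g u) * indicator {0..c} u \<partial>lborel)"
      unfolding distr by (subst nn_integral_density) (auto simp: mult.commute)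
    finally show ?thesis .
  qed
  have "E \<subseteq> (\<Union>i\<in>I. F i)"
  proof
    fix x assume x: "x \<in> E"
    obtain i where "i \<in> I" "\<forall>j\<in>I. V 0 (x i) \<le> V 0 (x j)"
      using ex_is_arg_min_if_finite[OF \<open>finite I\<close> \<open>I \<noteq> {}\<close>, of "\<lambda>i. V 0 (x i)"]
      by (auto simp: is_arg_min_def not_less)
    then show "x \<in> (\<Union>i\<in>I. F i)" using x by (auto simp: F_def)
  qed
  then have "emeasure (PiM I (\<lambda>_. Q)) E \<le> emeasure (PiM I (\<lambda>_. Q)) (\<Union>i\<in>I. F i)"
    using F \<open>finite I\<close> by (intro emeasure_mono sets.finite_UN) auto
  also have "\<dots> \<le> (\<Sum>i\<in>I. emeasure (PiM I (\<lambda>_. Q)) (F i))"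
    using F \<open>finite I\<close> by (intro emeasure_subadditive_finite) auto
  also have "\<dots> \<le> (\<Sum>i\<in>I. \<integral>\<^sup>+u. ennreal (g u) * indicator {0..c} u \<partial>lborel)"
    by (rule sum_mono) (rule F_le)
  also have "\<dots> = ennreal (real (Suc n)) * (\<integral>\<^sup>+u. ennreal (g u) * indicator {0..c} u \<partial>lborel)"
    by (simp add: n ennreal_of_nat_eq_real_of_nat del: of_nat_Suc)
  also have "\<dots> \<le> ennreal (\<Sum>k<Suc m. real (Suc n choose k) * a ^ k * (c - a) ^ (Suc n - k))"
    unfolding g_def by (rule nn_integral_binomial_recursion) (use Suc.prems in \<open>auto simp: c_def\<close>)
  finally show ?case unfolding E_def n c_def .
qed

section \<open>Randomised ranks\<close>

lemma space_Pl: "space (Pl M) = space M \<times> {0..1}"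
  by (simp add: Pl_def space_pair_measure space_restrict_space)

lemma prob_space_unit_interval: "prob_space (restrict_space lborel {0..1::real})"
  by (rule prob_spaceI) (simp add: emeasure_restrict_space space_restrict_space)

lemma Pl_Times:
  assumes "prob_space M" "A \<in> sets M" "B \<in> sets borel" "B \<subseteq> {0..1}"
  shows "A \<times> B \<in> sets (Pl M)" "emeasure (Pl M) (A \<times> B) = emeasure M A * emeasure lborel B"
proof -
  interpret L: prob_space "restrict_space lborel {0..1::real}" by (rule prob_space_unit_interval)
  have B: "B \<in> sets (restrict_space lborel {0..1::real})"
    using assms(3,4) by (simp add: sets_restrict_space_iff)
  show "A \<times> B \<in> sets (Pl M)" unfolding Pl_def using assms(2) B by simp
  show "emeasure (Pl M) (A \<times> B) = emeasure M A * emeasure lborel B"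
    unfolding Pl_def using assms B by (simp add: L.emeasure_pair_measure_Times emeasure_restrict_space)
qed

lemma prob_space_Pl:
  assumes "prob_space M" shows "prob_space (Pl M)"
proof -
  interpret prob_space M by fact
  show ?thesis
    by (rule prob_spaceI) (simp add: space_Pl Pl_Times(2)[OF assms] emeasure_space_1)
qed

lemma measurable_fst_Pl [measurable]: "fst \<in> measurable (Pl M) M"
  by (simp add: Pl_def)

lemma measurable_snd_Pl [measurable]: "snd \<in> borel_measurable (Pl M)"
proof -
  have "(\<lambda>x. x) \<in> measurable (restrict_space lborel {0..1::real}) borel"
    by (rule measurable_restrict_space1) simp
  from measurable_compose[OF measurable_snd this] show ?thesis by (simp add: Pl_def)
qed

text \<open>This is the purpose of the labels: points equivalent under \<open>leX\<close> share
  their label, so every equivalence class is null.\<close>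

lemma null_sets_snd_Pl:
  assumes "prob_space M"
  shows "{z \<in> space (Pl M). snd z = s} \<in> null_sets (Pl M)"
proof -
  have eq: "{z \<in> space (Pl M). snd z = s} = space M \<times> ({s} \<inter> {0..1})" by (auto simp: space_Pl)
  have "emeasure lborel ({s} \<inter> {0..1}) \<le> emeasure lborel {s}" by (rule emeasure_mono) auto
  then have "emeasure lborel ({s} \<inter> {0..1}) = 0" by simp
  then show ?thesis
    unfolding eq null_sets_def
    using Pl_Times[OF assms sets.top, of "{s} \<inter> {0..1}"] by simp
qed

lemma emeasure_Pl_fst:
  assumes "prob_space M" "A \<in> sets M"
  shows "emeasure (Pl M) {z \<in> space (Pl M). fst z \<in> A} = emeasure M A"
proof -
  have "{z \<in> space (Pl M). fst z \<in> A} = A \<times> {0..1}"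
    using sets.sets_into_space[OF assms(2)] by (auto simp: space_Pl)
  then show ?thesis using Pl_Times(2)[OF assms, of "{0..1}"] by simp
qed

text \<open>Carries bounds for labelled samples back to the original ones, since forgetting the
  labels preserves the product law.\<close>

lemma distr_PiM_Pl_fst:
  assumes M: "prob_space M" and I: "finite I"
  shows "distr (PiM I (\<lambda>_. Pl M)) (PiM I (\<lambda>_. M)) (\<lambda>x. \<lambda>i\<in>I. fst (x i)) = PiM I (\<lambda>_. M)"
proof -
  interpret prob_space M by fact
  interpret PM: product_sigma_finite "\<lambda>_. M" by standard
  interpret Q: prob_space "Pl M" by (rule prob_space_Pl[OF M])
  interpret PQ: product_sigma_finite "\<lambda>_. Pl M" by standard
  have [measurable]: "(\<lambda>x. \<lambda>i\<in>I. fst (x i)) \<in> measurable (PiM I (\<lambda>_. Pl M)) (PiM I (\<lambda>_. M))"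
    by measurable
  show ?thesis
  proof (rule PM.PiM_eqI[OF I])
    fix A assume A: "\<And>i. i \<in> I \<Longrightarrow> A i \<in> sets M"
    have "(\<lambda>x. \<lambda>i\<in>I. fst (x i)) -` PiE I A \<inter> space (PiM I (\<lambda>_. Pl M)) =
        PiE I (\<lambda>i. {z \<in> space (Pl M). fst z \<in> A i})"
      by (auto simp: space_PiM PiE_iff)
    moreover have "{z \<in> space (Pl M). fst z \<in> A i} \<in> sets (Pl M)" if "i \<in> I" for i
      using A[OF that] by measurable
    ultimately show "emeasure (distr (PiM I (\<lambda>_. Pl M)) (PiM I (\<lambda>_. M)) (\<lambda>x. \<lambda>i\<in>I. fst (x i))) (PiE I A)
        = (\<Prod>i\<in>I. emeasure M (A i))"
      using A I by (subst emeasure_distr)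
        (auto intro!: sets_PiM_I_finite prod.cong simp: PQ.emeasure_PiM emeasure_Pl_fst[OF M])
  qed simp
qed

lemma leX_trans: "leX U k p q \<Longrightarrow> leX U k q r \<Longrightarrow> leX U k p r"
  by (auto simp: leX_def)

lemma leX_antisym_snd: "leX U k p q \<Longrightarrow> leX U k q p \<Longrightarrow> snd p = snd q"
  by (auto simp: leX_def)

section \<open>Ranks of labelled points in the chain orders\<close>

locale chain_family = prob_space M for M :: "'xi measure" +
  fixes m :: nat and U :: "nat \<Rightarrow> 'xi \<Rightarrow> 'x set"
  assumes chain: "k < m \<Longrightarrow> a \<in> space M \<Longrightarrow> b \<in> space M \<Longrightarrow> U k a \<subseteq> U k b \<or> U k b \<subseteq> U k a"
    and sigma: "sigma_contains M m U"
begin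

sublocale Q: prob_space "Pl M"
  by (rule prob_space_Pl) (rule prob_space_axioms)

lemma sets_eq_class: "k < m \<Longrightarrow> x \<in> space M \<Longrightarrow> {y \<in> space M. U k y = U k x} \<in> sets M"
  and sets_below: "k < m \<Longrightarrow> x \<in> space M \<Longrightarrow> {y \<in> space M. U k y \<subseteq> U k x} \<in> sets M"
  using sigma by (auto simp: sigma_contains_def)

lemma sets_above:
  assumes "k < m" "x \<in> space M"
  shows "{y \<in> space M. U k x \<subseteq> U k y} \<in> sets M"
proof -
  have "{y \<in> space M. U k x \<subseteq> U k y} =
      (space M - {y \<in> space M. U k y \<subseteq> U k x}) \<union> {y \<in> space M. U k y = U k x}"
    using chain[OF assms(1) assms(2)] by auto
  then show ?thesis using sets_eq_class[OF assms] sets_below[OF assms] by auto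
qed

lemma leX_linear:
  "k < m \<Longrightarrow> p \<in> space (Pl M) \<Longrightarrow> q \<in> space (Pl M) \<Longrightarrow> leX U k p q \<or> leX U k q p"
  using chain[of k "fst p" "fst q"] by (auto simp: leX_def space_Pl)

lemma sets_leX_below:
  assumes "k < m" "q \<in> space (Pl M)"
  shows "{z \<in> space (Pl M). leX U k z q} \<in> sets (Pl M)"
proof -
  have q: "fst q \<in> space M" using assms(2) by (auto simp: space_Pl)
  note [measurable] = sets_eq_class[OF assms(1) q] sets_below[OF assms(1) q]
  have "{z \<in> space (Pl M). leX U k z q} =
      {z \<in> space (Pl M). (fst z \<in> {y \<in> space M. U k y \<subseteq> U k (fst q)} \<and>
        fst z \<notin> {y \<in> space M. U k y = U k (fst q)}) \<or>
        (fst z \<in> {y \<in> space M. U k y = U k (fst q)} \<and> snd z \<le> snd q)}"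
    by (auto simp: leX_def space_Pl)
  also have "\<dots> \<in> sets (Pl M)" by measurable
  finally show ?thesis .
qed

lemma sets_leX_above:
  assumes "k < m" "q \<in> space (Pl M)"
  shows "{z \<in> space (Pl M). leX U k q z} \<in> sets (Pl M)"
proof -
  have q: "fst q \<in> space M" using assms(2) by (auto simp: space_Pl)
  note [measurable] = sets_eq_class[OF assms(1) q] sets_above[OF assms(1) q]
  have "{z \<in> space (Pl M). leX U k q z} =
      {z \<in> space (Pl M). (fst z \<in> {y \<in> space M. U k (fst q) \<subseteq> U k y} \<and>
        fst z \<notin> {y \<in> space M. U k y = U k (fst q)}) \<or>
        (fst z \<in> {y \<in> space M. U k y = U k (fst q)} \<and> snd q \<le> snd z)}"
    by (auto simp: leX_def space_Pl)
  also have "\<dots> \<in> sets (Pl M)" by measurable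
  finally show ?thesis .
qed

lemma S_fun_antimono:
  assumes "k < m" "p \<in> space (Pl M)" "leX U k p q"
  shows "S_fun M U k q \<le> S_fun M U k p"
  unfolding S_fun_def using assms(3)
  by (intro Q.finite_measure_mono sets_leX_above[OF assms(1,2)]) (auto intro: leX_trans)

text \<open>The rank decreases along the order, so the superlevel set \<open>D\<close> is closed
  downwards. If the rank attains its minimum on \<open>D\<close> at \<open>p\<close>, then
  \<open>D\<close> is the ray below \<open>p\<close> together with one level set, which (A3) makes
  measurable. Otherwise \<open>D\<close> is the union of the rays below countably many points whose
  ranks approach the infimum.\<close>

lemma borel_measurable_S_fun:
  assumes A3: "A3 M m U" and k: "k < m"
  shows "S_fun M U k \<in> borel_measurable (Pl M)"
  unfolding borel_measurable_iff_greater
proof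
  fix \<beta> :: real
  define D where "D = {x \<in> space (Pl M). \<beta> < S_fun M U k x}"
  show "{x \<in> space (Pl M). \<beta> < S_fun M U k x} \<in> sets (Pl M)"
  proof (cases "\<exists>p\<in>D. \<forall>x\<in>D. S_fun M U k p \<le> S_fun M U k x")
    case True
    then obtain p where p: "p \<in> D" and min: "\<And>x. x \<in> D \<Longrightarrow> S_fun M U k p \<le> S_fun M U k x" by blast
    have ps: "p \<in> space (Pl M)" using p by (simp add: D_def)
    have "D = {x \<in> space (Pl M). leX U k x p} \<union> {x \<in> space (Pl M). S_fun M U k x = S_fun M U k p}"
    proof (intro equalityI subsetI)
      fix x assume x: "x \<in> D"
      then have xs: "x \<in> space (Pl M)" by (simp add: D_def)
      have "S_fun M U k x = S_fun M U k p" if "leX U k p x"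
        using min[OF x] S_fun_antimono[OF k ps that] by simp
      then show "x \<in> {x \<in> space (Pl M). leX U k x p} \<union> {x \<in> space (Pl M). S_fun M U k x = S_fun M U k p}"
        using leX_linear[OF k xs ps] xs by blast
    next
      fix x assume x: "x \<in> {x \<in> space (Pl M). leX U k x p} \<union> {x \<in> space (Pl M). S_fun M U k x = S_fun M U k p}"
      then have "S_fun M U k p \<le> S_fun M U k x" using S_fun_antimono[OF k, of x p] by auto
      then show "x \<in> D" using x p by (auto simp: D_def)
    qed
    moreover have "S_fun M U k p \<in> {0..1}" by (auto simp: S_fun_def)
    then have "{x \<in> space (Pl M). S_fun M U k x = S_fun M U k p} \<in> sets (Pl M)"
      using A3 k unfolding A3_def by blast
    ultimately show ?thesis using sets_leX_below[OF k ps] unfolding D_def by auto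
  next
    case False
    show ?thesis
    proof (cases "D = {}")
      case True
      then show ?thesis unfolding D_def by (simp only: sets.empty_sets)
    next
      case ne: False
      let ?s = "Inf (S_fun M U k ` D)"
      have bdd: "bdd_below (S_fun M U k ` D)" by (rule bdd_belowI[of _ 0]) (auto simp: S_fun_def)
      have "\<exists>p\<in>D. S_fun M U k p < ?s + 1 / real (Suc n)" for n
        using cInf_less_iff[of "S_fun M U k ` D" "?s + 1 / real (Suc n)"] ne bdd by simp
      then obtain p where p: "\<And>n. p n \<in> D" "\<And>n. S_fun M U k (p n) < ?s + 1 / real (Suc n)" by metis
      have ps: "p n \<in> space (Pl M)" for n using p(1)[of n] by (simp add: D_def)
      have "D = (\<Union>n. {x \<in> space (Pl M). leX U k x (p n)})"
      proof (intro equalityI subsetI)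
        fix x assume x: "x \<in> D"
        have "?s \<le> S_fun M U k x" using x bdd by (intro cInf_lower) auto
        moreover have "?s \<noteq> S_fun M U k x"
          using False x bdd by (metis cInf_lower imageI)
        ultimately have "0 < S_fun M U k x - ?s" by simp
        then obtain n where n: "1 / real (Suc n) < S_fun M U k x - ?s"
          using nat_approx_posE by metis
        have "\<not> leX U k (p n) x"
          using S_fun_antimono[OF k ps, of n x] p(2)[of n] n by auto
        then show "x \<in> (\<Union>n. {x \<in> space (Pl M). leX U k x (p n)})"
          using leX_linear[OF k ps, of x n] x by (auto simp: D_def)
      next
        fix x assume "x \<in> (\<Union>n. {x \<in> space (Pl M). leX U k x (p n)})"
        then obtain n where "x \<in> space (Pl M)" "leX U k x (p n)" by blast
        then show "x \<in> D"
          using S_fun_antimono[OF k, of x "p n"] p(1)[of n] by (simp add: D_def)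
      qed
      then show ?thesis
        using sets_leX_below[OF k ps] unfolding D_def by auto
    qed
  qed
qed

text \<open>If a level set \<open>Y\<close> had positive mass, (A4) would give \<open>p\<close> and
  \<open>q\<close> in \<open>Y\<close> whose order interval within \<open>Y\<close> has positive
  mass. Equal ranks mean that the points above \<open>p\<close> but not above \<open>q\<close> form
  a null set, and interval points that are also above \<open>q\<close> share the label of
  \<open>q\<close>, which is null too.\<close>

lemma measure_S_fun_level:
  assumes A3: "A3 M m U" and A4: "A4 M m U" and k: "k < m"
  shows "measure (Pl M) {x \<in> space (Pl M). S_fun M U k x = \<beta>} = 0"
proof (rule ccontr)
  note [measurable] = borel_measurable_S_fun[OF A3 k]
  define Y where "Y = {x \<in> space (Pl M). S_fun M U k x = \<beta>}"
  have Y: "Y \<in> sets (Pl M)" unfolding Y_def by measurable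
  assume "measure (Pl M) {x \<in> space (Pl M). S_fun M U k x = \<beta>} \<noteq> 0"
  then have pos: "measure (Pl M) Y > 0" by (simp add: Y_def zero_less_measure_iff)
  then have ne: "Y \<noteq> {}" by auto
  have "0 < (SUP p\<in>Y \<times> Y. measure (Pl M) {z \<in> Y. leX U k (fst p) z \<and> leX U k z (snd p)})"
    using A4 Y pos k unfolding A4_def by blast
  then have "\<exists>p\<in>Y \<times> Y. 0 < measure (Pl M) {z \<in> Y. leX U k (fst p) z \<and> leX U k z (snd p)}"
    using ne by (subst (asm) less_cSUP_iff) (auto intro!: bdd_aboveI[of _ 1])
  then obtain p q where pq: "p \<in> Y" "q \<in> Y" and
    pos2: "0 < measure (Pl M) {z \<in> Y. leX U k p z \<and> leX U k z q}" by auto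
  have sp: "p \<in> space (Pl M)" "q \<in> space (Pl M)" using pq by (auto simp: Y_def)
  have "{z \<in> Y. leX U k p z \<and> leX U k z q} \<noteq> {}"
    using pos2 by (metis less_irrefl measure_empty)
  then have le: "leX U k p q" using leX_trans by blast
  let ?up = "\<lambda>x. {z \<in> space (Pl M). leX U k x z}"
  have "measure (Pl M) {z \<in> Y. leX U k p z \<and> leX U k z q} \<le>
      measure (Pl M) ((?up p - ?up q) \<union> {z \<in> space (Pl M). snd z = snd q})"
  proof (rule Q.finite_measure_mono)
    show "{z \<in> Y. leX U k p z \<and> leX U k z q} \<subseteq> (?up p - ?up q) \<union> {z \<in> space (Pl M). snd z = snd q}"
      by (auto simp: Y_def dest: leX_antisym_snd)
  qed (intro sets.Un sets.Diff sets_leX_above k sp, measurable)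
  also have "\<dots> \<le> measure (Pl M) (?up p - ?up q) + measure (Pl M) {z \<in> space (Pl M). snd z = snd q}"
    by (intro measure_Un_le sets.Diff sets_leX_above k sp) measurable
  also have "measure (Pl M) {z \<in> space (Pl M). snd z = snd q} = 0"
    using null_sets_snd_Pl[OF prob_space_axioms] by (rule measure_eq_0_null_sets)
  also have "measure (Pl M) (?up p - ?up q) = S_fun M U k p - S_fun M U k q"
    unfolding S_fun_def
    by (intro Q.finite_measure_Diff sets_leX_above k sp) (use le leX_trans in blast)
  also have "\<dots> = 0" using pq by (simp add: Y_def)
  finally show False using pos2 by simp
qed

end

section \<open>The degree of feasibility\<close>

lemma chain_least_element:
  assumes "finite I" "I \<noteq> {}" "\<And>i j. i \<in> I \<Longrightarrow> j \<in> I \<Longrightarrow> W i \<subseteq> W j \<or> W j \<subseteq> W i"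
  shows "\<exists>i\<in>I. \<forall>j\<in>I. W i \<subseteq> W j"
  using assms
proof (induction I rule: finite_ne_induct)
  case (insert i I)
  then obtain l where l: "l \<in> I" "\<forall>j\<in>I. W l \<subseteq> W j" by (metis insertCI)
  have "W i \<subseteq> W l \<or> W l \<subseteq> W i" using insert.prems l by blast
  then show ?case using l by (metis insert_iff order.trans order.refl)
qed simp

context chain_family
begin

text \<open>A finite chain has a least member, and that member is the intersection. For
  \<open>N = 0\<close> the intersection is the whole space and the equivalence can fail.\<close>

lemma INT_subset_iff:
  fixes N :: nat
  assumes "1 \<le> N" "k < m" "s \<in> {..<N} \<rightarrow> space M"
  shows "(\<Inter>i<N. U k (s i)) \<subseteq> T \<longleftrightarrow> (\<exists>i<N. U k (s i) \<subseteq> T)"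
proof
  have "\<exists>i\<in>{..<N}. \<forall>j\<in>{..<N}. U k (s i) \<subseteq> U k (s j)"
  proof (rule chain_least_element)
    fix i j assume "i \<in> {..<N}" "j \<in> {..<N}"
    then show "U k (s i) \<subseteq> U k (s j) \<or> U k (s j) \<subseteq> U k (s i)"
      using assms by (intro chain) auto
  qed (use assms(1) in \<open>auto simp: lessThan_empty_iff\<close>)
  then obtain i where i: "i < N" "\<forall>j<N. U k (s i) \<subseteq> U k (s j)" by auto
  assume "(\<Inter>i<N. U k (s i)) \<subseteq> T"
  moreover have "U k (s i) \<subseteq> (\<Inter>i<N. U k (s i))" using i by auto
  ultimately show "\<exists>i<N. U k (s i) \<subseteq> T" using i(1) by blast
qed blast

lemma sets_frakD_event:
  fixes N :: nat
  assumes "1 \<le> N" "s \<in> {..<N} \<rightarrow> space M"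
  shows "{\<xi> \<in> space M. \<forall>k<m. (\<Inter>i<N. U k (s i)) \<subseteq> U k \<xi>} \<in> sets M"
proof -
  have "{\<xi> \<in> space M. \<forall>k\<in>{..<m}. \<exists>i\<in>{..<N}. U k (s i) \<subseteq> U k \<xi>} \<in> sets M"
    by (intro sets.sets_Collect_finite_All sets.sets_Collect_finite_Ex sets_above) (use assms in auto)
  also have "{\<xi> \<in> space M. \<forall>k\<in>{..<m}. \<exists>i\<in>{..<N}. U k (s i) \<subseteq> U k \<xi>} =
      {\<xi> \<in> space M. \<forall>k<m. (\<Inter>i<N. U k (s i)) \<subseteq> U k \<xi>}"
    using INT_subset_iff[OF assms(1) _ assms(2)] by blast
  finally show ?thesis .
qed

text \<open>A violated inclusion in chain \<open>k\<close> puts the point strictly below every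
  sampled point, hence its rank at or above all theirs. The ranks decrease along the chain, so their
  negatives play the part of the functions in \<open>exceedance_bound\<close>.\<close>

lemma frakD_less_imp_exceed:
  assumes A3: "A3 M m U" and A4: "A4 M m U" and N: "1 \<le> N"
    and x: "x \<in> {..<N} \<rightarrow> space (Pl M)" and less: "frakD M m U N (\<lambda>i\<in>{..<N}. fst (x i)) < 1 - \<alpha>"
  shows "\<alpha> < measure (Pl M) {z \<in> space (Pl M). \<exists>k<m. \<forall>i\<in>{..<N}. - S_fun M U k z < - S_fun M U k (x i)}"
proof -
  let ?s = "\<lambda>i\<in>{..<N}. fst (x i)"
  define G where "G = {\<xi> \<in> space M. \<forall>k<m. (\<Inter>i<N. U k (?s i)) \<subseteq> U k \<xi>}"
  let ?B = "{z \<in> space (Pl M). \<exists>k<m. \<forall>i\<in>{..<N}. - S_fun M U k z < - S_fun M U k (x i)}"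
  \<comment> \<open>Order gives only weak inequality of ranks; \<open>L\<close> collects the points
    where it is not strict, a finite union of null level sets.\<close>
  define L where "L = (\<Union>k\<in>{..<m}. \<Union>i\<in>{..<N}. {z \<in> space (Pl M). S_fun M U k z = S_fun M U k (x i)})"
  have xs: "x i \<in> space (Pl M)" "fst (x i) \<in> space M" if "i < N" for i
    using Pi_mem[OF x, of i] that by (auto simp: space_Pl mem_Times_iff)
  have s: "?s \<in> {..<N} \<rightarrow> space M" using xs by auto
  have G: "G \<in> sets M" unfolding G_def by (rule sets_frakD_event[OF N s])
  have S_meas: "S_fun M U k \<in> borel_measurable (Pl M)" if "k < m" for k
    by (rule borel_measurable_S_fun[OF A3 that])
  have L_null: "L \<in> null_sets (Pl M)"
    unfolding L_def
  proof (intro null_sets_UN' countable_finite finite_lessThan)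
    fix k i assume "k \<in> {..<m}" "i \<in> {..<N}"
    then have k: "k < m" by simp
    note [measurable] = S_meas[OF k]
    have "{z \<in> space (Pl M). S_fun M U k z = S_fun M U k (x i)} \<in> sets (Pl M)" by measurable
    then show "{z \<in> space (Pl M). S_fun M U k z = S_fun M U k (x i)} \<in> null_sets (Pl M)"
      using measure_S_fun_level[OF A3 A4 k] by (auto intro!: null_setsI simp: Q.emeasure_eq_measure)
  qed
  have B: "?B \<in> sets (Pl M)"
  proof -
    have "{z \<in> space (Pl M). \<exists>k\<in>{..<m}. \<forall>i\<in>{..<N}. - S_fun M U k z < - S_fun M U k (x i)} \<in> sets (Pl M)"
    proof (intro sets.sets_Collect_finite_All sets.sets_Collect_finite_Ex finite_lessThan)
      fix k i assume "k \<in> {..<m}"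
      then have [measurable]: "S_fun M U k \<in> borel_measurable (Pl M)" by (simp add: S_meas)
      show "{z \<in> space (Pl M). - S_fun M U k z < - S_fun M U k (x i)} \<in> sets (Pl M)" by measurable
    qed
    then show ?thesis by (simp only: Bex_def lessThan_iff)
  qed
  have "\<alpha> < 1 - measure M G" using less by (simp add: frakD_def G_def)
  also have "1 - measure M G = measure M (space M - G)" using prob_compl[OF G] by simp
  also have "\<dots> = measure (Pl M) {z \<in> space (Pl M). fst z \<in> space M - G}"
    unfolding measure_def using G by (subst emeasure_Pl_fst[OF prob_space_axioms]) auto
  also have "\<dots> \<le> measure (Pl M) (?B \<union> L)"
  proof (rule Q.finite_measure_mono)
    show "{z \<in> space (Pl M). fst z \<in> space M - G} \<subseteq> ?B \<union> L"
    proof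
      fix z assume z: "z \<in> {z \<in> space (Pl M). fst z \<in> space M - G}"
      then have zs: "z \<in> space (Pl M)" "fst z \<in> space M" by auto
      obtain k where k: "k < m" "\<not> (\<Inter>i<N. U k (?s i)) \<subseteq> U k (fst z)"
        using z by (auto simp: G_def)
      have "leX U k z (x i)" if i: "i < N" for i
      proof -
        have "\<not> U k (fst (x i)) \<subseteq> U k (fst z)"
          using k(2) i unfolding INT_subset_iff[OF N k(1) s] by auto
        then show ?thesis using chain[OF k(1) zs(2) xs(2)[OF i]] by (auto simp: leX_def)
      qed
      then have le: "S_fun M U k (x i) \<le> S_fun M U k z" if "i < N" for i
        using S_fun_antimono[OF k(1) zs(1)] that by blast
      show "z \<in> ?B \<union> L"
      proof (cases "\<exists>i<N. S_fun M U k z = S_fun M U k (x i)")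
        case True
        then have "z \<in> L" unfolding L_def using k(1) zs(1) by blast
        then show ?thesis by blast
      next
        case False
        have "\<forall>i\<in>{..<N}. - S_fun M U k z < - S_fun M U k (x i)"
        proof
          fix i assume "i \<in> {..<N}"
          then have "S_fun M U k z \<noteq> S_fun M U k (x i)" "S_fun M U k (x i) \<le> S_fun M U k z"
            using False le by auto
          then show "- S_fun M U k z < - S_fun M U k (x i)" by linarith
        qed
        then have "z \<in> ?B" using k(1) zs(1) by blast
        then show ?thesis by blast
      qed
    qed
  qed (intro sets.Un B null_setsD2 L_null)
  also have "\<dots> = measure (Pl M) ?B"
    using B L_null by (rule measure_Un_null_set)
  finally show ?thesis .
qed

lemma measure_frakD_less:
  assumes A: "A1 M N m U" "A3 M m U" "A4 M m U" and N: "1 \<le> N" "m \<le> N" and \<alpha>: "\<alpha> \<in> {0..1}"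
  shows "measure (PN M N) {s \<in> space (PN M N). frakD M m U N s < 1 - \<alpha>}
      \<le> (\<Sum>k<m. real (N choose k) * \<alpha> ^ k * (1 - \<alpha>) ^ (N - k))"
proof -
  let ?I = "{..<N}"
  let ?P = "PiM ?I (\<lambda>_. M)" and ?Q = "PiM ?I (\<lambda>_. Pl M)"
  define p where "p = (\<lambda>x::nat \<Rightarrow> 'xi \<times> real. \<lambda>i\<in>?I. fst (x i))"
  interpret QN: prob_space ?Q by (rule prob_space_PiM) (rule Q.prob_space_axioms)
  let ?B = "{s \<in> space (PN M N). frakD M m U N s < 1 - \<alpha>}"
  have "?B \<in> sets (completion ?P)"
    using A(1) unfolding A1_def PN_def by measurable
  \<comment> \<open>(A1) places the event only in the completed \<sigma>-algebra. Its main part has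
    the same mass and lies in the uncompleted product, where it can be pulled back along
    \<open>p\<close>.\<close>
  define B0 where "B0 = main_part ?P ?B"
  have B0: "B0 \<in> sets ?P" unfolding B0_def by (rule main_part_sets) fact
  have B0_sub: "B0 \<subseteq> ?B"
    unfolding B0_def using main_part_null_part_Un[OF \<open>?B \<in> sets (completion ?P)\<close>] by blast
  have B0_eq: "measure (PN M N) ?B = measure ?P B0"
    using \<open>?B \<in> sets (completion ?P)\<close> by (simp add: B0_def PN_def measure_def)
  have p [measurable]: "p \<in> measurable ?Q ?P" unfolding p_def by measurable
  define V where "V k z = - S_fun M U k z" for k z
  have V_meas: "V k \<in> borel_measurable (Pl M)" if "k < m" for k
    using borel_measurable_S_fun[OF A(2) that] by (auto simp: V_def[abs_def])
  have V_null: "measure (Pl M) {z \<in> space (Pl M). V k z = v} = 0" if "k < m" for k v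
  proof -
    have "{z \<in> space (Pl M). V k z = v} = {z \<in> space (Pl M). S_fun M U k z = - v}"
      by (auto simp: V_def)
    then show ?thesis using measure_S_fun_level[OF A(2,3) that, of "- v"] by (simp only:)
  qed
  let ?F = "{x \<in> space ?Q. \<alpha> < measure (Pl M) {z \<in> space (Pl M). \<exists>k<m. \<forall>i\<in>?I. V k z < V k (x i)}}"
  have "ennreal (measure ?P B0) = emeasure (distr ?Q ?P p) B0"
    unfolding p_def distr_PiM_Pl_fst[OF prob_space_axioms finite_lessThan]
    by (rule finite_measure.emeasure_eq_measure[symmetric])
       (rule prob_space.finite_measure, rule prob_space_PiM, rule prob_space_axioms)
  also have "\<dots> = emeasure ?Q (p -` B0 \<inter> space ?Q)"
    using B0 by (subst emeasure_distr) auto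
  also have "\<dots> \<le> emeasure ?Q ?F"
  proof (rule emeasure_mono)
    show "p -` B0 \<inter> space ?Q \<subseteq> ?F"
    proof
      fix x assume x: "x \<in> p -` B0 \<inter> space ?Q"
      then have "frakD M m U N (p x) < 1 - \<alpha>" using B0_sub by auto
      moreover have "x \<in> ?I \<rightarrow> space (Pl M)" using x by (auto simp: space_PiM)
      ultimately show "x \<in> ?F"
        using frakD_less_imp_exceed[OF A(2,3) N(1), of x \<alpha>] x by (simp add: p_def V_def)
    qed
    show "?F \<in> sets ?Q"
      by (rule sets_exceed) (use V_meas Q.finite_measure_axioms in auto)
  qed
  also have "\<dots> \<le> ennreal (\<Sum>k<m. real (card ?I choose k) * \<alpha> ^ k * (measure (Pl M) (space (Pl M)) - \<alpha>) ^ (card ?I - k))"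
    by (rule exceedance_bound) (use V_meas V_null Q.finite_measure_axioms N \<alpha> Q.prob_space in auto)
  finally show ?thesis
    unfolding B0_eq using \<alpha> by (subst (asm) ennreal_le_iff) (auto simp: Q.prob_space intro!: sum_nonneg)
qed

end

section \<open>Outer probability and comparison of the three degrees of feasibility\<close>

lemma bdd_below_outer_prob: "bdd_below {measure M B | B. B \<in> sets M \<and> A \<subseteq> B}"
  by (rule bdd_belowI[of _ 0]) auto

lemma outer_prob_le: "B \<in> sets M \<Longrightarrow> A \<subseteq> B \<Longrightarrow> outer_prob M A \<le> measure M B"
  unfolding outer_prob_def by (rule cInf_lower[OF _ bdd_below_outer_prob]) auto

text \<open>Every cover of \<open>B\<close> covers \<open>A\<close>. The inclusion
  \<open>B \<subseteq> space M\<close> guarantees that a measurable cover exists, without which the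
  real infimum would say nothing.\<close>

lemma outer_prob_mono:
  assumes "A \<subseteq> B" "B \<subseteq> space M"
  shows "outer_prob M A \<le> outer_prob M B"
  unfolding outer_prob_def using assms
  by (intro cInf_superset_mono bdd_below_outer_prob) auto

lemma measure_le_outer_prob:
  assumes "finite_measure M" "A \<subseteq> B" "B \<subseteq> space M"
  shows "measure M A \<le> outer_prob M B"
  unfolding outer_prob_def
  using assms(3) by (intro cInf_greatest) (use assms in \<open>auto intro: finite_measure.finite_measure_mono\<close>)

lemma SAA_less_infinity_imp:
  assumes f: "\<And>\<xi> x. f \<xi> x \<noteq> -\<infinity>" and "1 \<le> N" "SAA f N s x < \<infinity>" "i < N"
  shows "x \<in> dom_f f (s i)"
proof (rule ccontr)
  assume "x \<notin> dom_f f (s i)"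
  then have "f (s i) x = \<infinity>" by (simp add: dom_f_def)
  then have "(\<Sum>i<N. f (s i) x) = \<infinity>" using \<open>i < N\<close> by (subst sum_Pinfty) auto
  then show False using assms(2,3) by (simp add: SAA_def)
qed

text \<open>A finite sample average puts \<open>x\<close> into every sampled domain, hence into any
  domain that contains their intersection.\<close>

lemma d_feas_ge_D_feas:
  assumes f: "\<And>\<xi> x. f \<xi> x \<noteq> -\<infinity>" and "1 \<le> N" "SAA f N s x < \<infinity>"
  shows "D_feas M f N s \<le> d_feas M f x"
  unfolding D_feas_def d_feas_def
  by (rule outer_prob_mono) (use SAA_less_infinity_imp[OF f assms(2,3)] in blast)+

lemma frakD_le_D_feas:
  assumes "finite_measure M" "chain_constrained M f m U" "s \<in> {..<N} \<rightarrow> space M"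
  shows "frakD M m U N s \<le> D_feas M f N s"
  unfolding frakD_def D_feas_def
proof (rule measure_le_outer_prob[OF assms(1)])
  have dom: "dom_f f \<xi> = (\<Inter>k<m. U k \<xi>)" if "\<xi> \<in> space M" for \<xi>
    using assms(2) that by (auto simp: chain_constrained_def)
  show "{\<xi> \<in> space M. \<forall>k<m. (\<Inter>i<N. U k (s i)) \<subseteq> U k \<xi>}
    \<subseteq> {\<xi> \<in> space M. (\<Inter>i<N. dom_f f (s i)) \<subseteq> dom_f f \<xi>}"
  proof safe
    fix \<xi> x assume *: "\<xi> \<in> space M" "\<forall>k<m. (\<Inter>i<N. U k (s i)) \<subseteq> U k \<xi>" "x \<in> (\<Inter>i<N. dom_f f (s i))"
    have "x \<in> U k (s i)" if "k < m" "i < N" for k i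
      using *(3) dom[of "s i"] assms(3) that by auto
    then have "x \<in> (\<Inter>i<N. U k (s i))" if "k < m" for k using that by blast
    then show "x \<in> dom_f f \<xi>" using * by (simp add: dom) blast
  qed
qed auto

section \<open>Chains induced by functional constraints\<close>

text \<open>Inclusion fails exactly when some value of \<open>c\<close> lies in the half-open
  interval from \<open>l b\<close> to \<open>l a\<close>; by \<open>countable_hitting_set\<close>
  countably many values decide this, so the failure set is a countable union of measurable
  sets.\<close>

lemma pred_sublevel_subset:
  fixes c :: "'x \<Rightarrow> real" and l :: "'xi \<Rightarrow> real"
  assumes l [measurable]: "l \<in> borel_measurable M"
    and U: "\<And>\<xi>. \<xi> \<in> space M \<Longrightarrow> U \<xi> = {x. c x \<le> l \<xi>}"
  shows "Measurable.pred (M \<Otimes>\<^sub>M M) (\<lambda>p. U (fst p) \<subseteq> U (snd p))"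
proof -
  obtain C where C: "countable C" "C \<subseteq> range c"
    "\<And>s t. range c \<inter> {s<..t} \<noteq> {} \<Longrightarrow> C \<inter> {s<..t} \<noteq> {}"
    using countable_hitting_set by metis
  have iff: "U a \<subseteq> U b \<longleftrightarrow> (\<forall>r\<in>C. r \<le> l a \<longrightarrow> r \<le> l b)" if "a \<in> space M" "b \<in> space M" for a b
  proof
    assume "U a \<subseteq> U b"
    then show "\<forall>r\<in>C. r \<le> l a \<longrightarrow> r \<le> l b" using C(2) U that by auto
  next
    assume R: "\<forall>r\<in>C. r \<le> l a \<longrightarrow> r \<le> l b"
    show "U a \<subseteq> U b"
    proof (rule ccontr)
      assume "\<not> U a \<subseteq> U b"
      then obtain x where "x \<in> U a" "x \<notin> U b" by blast
      then have "c x \<in> {l b<..l a}" using U that by auto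
      then have "C \<inter> {l b<..l a} \<noteq> {}" by (intro C(3)) blast
      then show False using R by auto
    qed
  qed
  let ?V = "\<lambda>r. {p \<in> space (M \<Otimes>\<^sub>M M). r \<le> l (fst p) \<and> \<not> r \<le> l (snd p)}"
  have "?V r \<in> sets (M \<Otimes>\<^sub>M M)" for r by measurable
  then have "space (M \<Otimes>\<^sub>M M) - (\<Union>r\<in>C. ?V r) \<in> sets (M \<Otimes>\<^sub>M M)"
    using C(1) by (intro sets.Diff sets.top sets.countable_UN') blast+
  also have "space (M \<Otimes>\<^sub>M M) - (\<Union>r\<in>C. ?V r) = {p \<in> space (M \<Otimes>\<^sub>M M). U (fst p) \<subseteq> U (snd p)}"
    using iff by (fastforce simp: space_pair_measure)
  finally show ?thesis by (simp add: pred_def)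
qed

text \<open>If all sections were null, Fubini in one order would make the graph of \<open>R\<close>
  on \<open>Y\<close> null and Fubini in the other order its transpose. By totality the two cover
  \<open>Y \<times> Y\<close>, whose mass is positive.\<close>

lemma exists_positive_section:
  assumes Q: "prob_space Q" and Y [measurable]: "Y \<in> sets Q" and pos: "measure Q Y > 0"
    and R [measurable]: "Measurable.pred (Q \<Otimes>\<^sub>M Q) (\<lambda>p. R (fst p) (snd p))"
    and total: "\<And>p q. p \<in> Y \<Longrightarrow> q \<in> Y \<Longrightarrow> R p q \<or> R q p"
  shows "\<exists>p\<in>Y. measure Q {z \<in> Y. R p z} > 0"
proof (rule ccontr)
  interpret Q: prob_space Q by fact
  interpret pair_prob_space Q Q ..
  assume "\<not> (\<exists>p\<in>Y. measure Q {z \<in> Y. R p z} > 0)"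
  then have null: "emeasure Q {z \<in> Y. R p z} = 0" if "p \<in> Y" for p
    using that by (auto simp: Q.emeasure_eq_measure zero_less_measure_iff)
  define W where "W = {p \<in> space (Q \<Otimes>\<^sub>M Q). fst p \<in> Y \<and> snd p \<in> Y \<and> R (fst p) (snd p)}"
  define W' where "W' = {p \<in> space (Q \<Otimes>\<^sub>M Q). fst p \<in> Y \<and> snd p \<in> Y \<and> R (snd p) (fst p)}"
  have R': "Measurable.pred (Q \<Otimes>\<^sub>M Q) (\<lambda>p. R (snd p) (fst p))"
    using measurable_compose[OF measurable_pair_swap' R] by (simp add: split_beta')
  have W [measurable]: "W \<in> sets (Q \<Otimes>\<^sub>M Q)" unfolding W_def by measurable
  have W' [measurable]: "W' \<in> sets (Q \<Otimes>\<^sub>M Q)"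
    unfolding W'_def using R' by measurable
  have Y_sub: "Y \<subseteq> space Q" by (rule sets.sets_into_space) fact
  have "Pair p -` W = (if p \<in> Y then {z \<in> Y. R p z} else {})" for p
    using Y_sub by (auto simp: W_def space_pair_measure)
  then have "emeasure Q (Pair p -` W) = 0" for p
    using null[of p] by (cases "p \<in> Y") simp_all
  then have "emeasure (Q \<Otimes>\<^sub>M Q) W = 0"
    by (simp add: Q.emeasure_pair_measure_alt[OF W])
  moreover have "(\<lambda>x. (x, p)) -` W' = (if p \<in> Y then {z \<in> Y. R p z} else {})" for p
    using Y_sub by (auto simp: W'_def space_pair_measure)
  then have "emeasure Q ((\<lambda>x. (x, p)) -` W') = 0" for p
    using null[of p] by (cases "p \<in> Y") simp_all
  then have "emeasure (Q \<Otimes>\<^sub>M Q) W' = 0"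
    by (simp add: emeasure_pair_measure_alt2[OF W'])
  moreover have "emeasure (Q \<Otimes>\<^sub>M Q) (Y \<times> Y) \<le> emeasure (Q \<Otimes>\<^sub>M Q) (W \<union> W')"
  proof (rule emeasure_mono)
    show "Y \<times> Y \<subseteq> W \<union> W'"
    proof clarify
      fix p q assume "p \<in> Y" "q \<in> Y" "(p, q) \<notin> W'"
      then show "(p, q) \<in> W"
        using total[of p q] Y_sub by (auto simp: W_def W'_def space_pair_measure)
    qed
  qed (intro sets.Un W W')
  moreover have "emeasure (Q \<Otimes>\<^sub>M Q) (W \<union> W') \<le> emeasure (Q \<Otimes>\<^sub>M Q) W + emeasure (Q \<Otimes>\<^sub>M Q) W'"
    by (rule emeasure_subadditive) measurable
  ultimately have "emeasure (Q \<Otimes>\<^sub>M Q) (Y \<times> Y) = 0" by simp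
  then have "emeasure Q Y * emeasure Q Y = 0"
    by (simp add: Q.emeasure_pair_measure_Times)
  then show False using pos by (simp add: Q.emeasure_eq_measure)
qed

text \<open>\<open>sigma_contains\<close> makes inclusion measurable in one argument with the other
  fixed; the Fubini arguments below need it jointly in both.\<close>

locale measurable_chain_family = chain_family M m U for M :: "'xi measure" and m and U :: "nat \<Rightarrow> 'xi \<Rightarrow> 'x set" +
  assumes pred_subset: "k < m \<Longrightarrow> Measurable.pred (M \<Otimes>\<^sub>M M) (\<lambda>p. U k (fst p) \<subseteq> U k (snd p))"
begin

lemma pred_subset_compose:
  assumes "k < m" "f \<in> measurable K M" "g \<in> measurable K M"
  shows "Measurable.pred K (\<lambda>x. U k (f x) \<subseteq> U k (g x))"
  using measurable_compose[OF measurable_Pair[OF assms(2,3)] pred_subset[OF assms(1)]] by simp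

lemma pred_leX:
  assumes k: "k < m" and f [measurable]: "f \<in> measurable K (Pl M)" and g [measurable]: "g \<in> measurable K (Pl M)"
  shows "Measurable.pred K (\<lambda>x. leX U k (f x) (g x))"
proof -
  have [measurable]: "Measurable.pred K (\<lambda>x. U k (fst (f x)) \<subseteq> U k (fst (g x)))"
    "Measurable.pred K (\<lambda>x. U k (fst (g x)) \<subseteq> U k (fst (f x)))"
    by (intro pred_subset_compose k; measurable)+
  have "Measurable.pred K (\<lambda>x. (U k (fst (f x)) \<subseteq> U k (fst (g x)) \<and> \<not> U k (fst (g x)) \<subseteq> U k (fst (f x))) \<or>
      (U k (fst (f x)) \<subseteq> U k (fst (g x)) \<and> U k (fst (g x)) \<subseteq> U k (fst (f x)) \<and> snd (f x) \<le> snd (g x)))"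
    by measurable
  also have "(\<lambda>x. (U k (fst (f x)) \<subseteq> U k (fst (g x)) \<and> \<not> U k (fst (g x)) \<subseteq> U k (fst (f x))) \<or>
      (U k (fst (f x)) \<subseteq> U k (fst (g x)) \<and> U k (fst (g x)) \<subseteq> U k (fst (f x)) \<and> snd (f x) \<le> snd (g x)))
      = (\<lambda>x. leX U k (f x) (g x))"
    by (auto simp: leX_def fun_eq_iff)
  finally show ?thesis .
qed

lemma pred_ltX:
  assumes "k < m" "f \<in> measurable K (Pl M)" "g \<in> measurable K (Pl M)"
  shows "Measurable.pred K (\<lambda>x. ltX U k (f x) (g x))"
  unfolding ltX_def by (intro pred_intros_logic pred_leX assms)

lemma pred_eqX:
  assumes "k < m" "f \<in> measurable K (Pl M)" "g \<in> measurable K (Pl M)"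
  shows "Measurable.pred K (\<lambda>x. eqX U k (f x) (g x))"
  unfolding eqX_def by (intro pred_intros_logic pred_leX assms)

lemma A1_holds:
  assumes N: "1 \<le> N"
  shows "A1 M N m U"
proof -
  let ?P = "PiM {..<N} (\<lambda>_. M)"
  have "Measurable.pred (?P \<Otimes>\<^sub>M M) (\<lambda>(s, \<xi>). \<forall>k\<in>{..<m}. \<exists>i\<in>{..<N}. U k (s i) \<subseteq> U k \<xi>)"
    unfolding split_beta'
  proof (intro pred_intros_finite finite_lessThan)
    fix k i assume "k \<in> {..<m}" "i \<in> {..<N}"
    then show "Measurable.pred (?P \<Otimes>\<^sub>M M) (\<lambda>p. U k (fst p i) \<subseteq> U k (snd p))"
      by (intro pred_subset_compose) auto
  qed
  then have "(\<lambda>s. measure M {\<xi> \<in> space M. \<forall>k\<in>{..<m}. \<exists>i\<in>{..<N}. U k (s i) \<subseteq> U k \<xi>}) \<in> borel_measurable ?P"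
    by (rule borel_measurable_measure_Collect)
  moreover have "frakD M m U N s = measure M {\<xi> \<in> space M. \<forall>k\<in>{..<m}. \<exists>i\<in>{..<N}. U k (s i) \<subseteq> U k \<xi>}"
    if "s \<in> space ?P" for s
  proof -
    have "s \<in> {..<N} \<rightarrow> space M" using that by (auto simp: space_PiM)
    then show ?thesis
      unfolding frakD_def using INT_subset_iff[OF N]
      by (intro arg_cong[where f = "measure M"]) blast
  qed
  ultimately have "(\<lambda>s. frakD M m U N s) \<in> borel_measurable ?P"
    by (subst measurable_cong) auto
  then show ?thesis unfolding A1_def PN_def by (rule measurable_completion)
qed

lemma A3_holds: "A3 M m U"
  unfolding A3_def
proof (intro allI impI ballI)
  fix k \<beta> assume k: "k < m"
  have "Measurable.pred (Pl M \<Otimes>\<^sub>M Pl M) (\<lambda>(x, y). leX U k x y)"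
    unfolding split_beta' by (intro pred_leX k) auto
  then have [measurable]: "S_fun M U k \<in> borel_measurable (Pl M)"
    unfolding S_fun_def by (rule Q.borel_measurable_measure_Collect)
  show "{x \<in> space (Pl M). S_fun M U k x = \<beta>} \<in> sets (Pl M)" by measurable
qed

text \<open>Two uses of \<open>exists_positive_section\<close>: the first finds \<open>p\<close>
  with a massive part of \<open>Y\<close> above it, the second, with the order reversed on that
  part, finds the upper end \<open>q\<close>.\<close>

lemma A4_holds: "A4 M m U"
  unfolding A4_def
proof (intro allI ballI impI)
  fix Y k assume Y: "Y \<in> sets (Pl M)" and pos: "0 < measure (Pl M) Y" and k: "k < m"
  have Y_sub: "Y \<subseteq> space (Pl M)" using Y by (rule sets.sets_into_space)
  have "\<exists>p\<in>Y. 0 < measure (Pl M) {z \<in> Y. leX U k p z}"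
    by (rule exists_positive_section[OF Q.prob_space_axioms Y pos pred_leX[OF k]])
       (use leX_linear[OF k] Y_sub in blast)+
  then obtain p where p: "p \<in> Y" and pos_p: "0 < measure (Pl M) {z \<in> Y. leX U k p z}" by blast
  define Y' where "Y' = {z \<in> Y. leX U k p z}"
  have Y': "Y' \<in> sets (Pl M)"
  proof -
    have "Y' = Y \<inter> {z \<in> space (Pl M). leX U k p z}" using Y_sub by (auto simp: Y'_def)
    moreover have "p \<in> space (Pl M)" using p Y_sub by blast
    ultimately show ?thesis using sets.Int[OF Y sets_leX_above[OF k]] by (simp only:)
  qed
  have "\<exists>q\<in>Y'. 0 < measure (Pl M) {z \<in> Y'. leX U k z q}"
  proof (rule exists_positive_section[OF Q.prob_space_axioms Y' _ pred_leX[OF k]])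
    show "0 < measure (Pl M) Y'" using pos_p by (simp add: Y'_def)
    show "leX U k z y \<or> leX U k y z" if "y \<in> Y'" "z \<in> Y'" for y z
      using leX_linear[OF k, of z y] that Y_sub unfolding Y'_def by blast
  qed auto
  then obtain q where q: "q \<in> Y'" and pos_q: "0 < measure (Pl M) {z \<in> Y'. leX U k z q}" by blast
  have "{z \<in> Y'. leX U k z q} = {z \<in> Y. leX U k p z \<and> leX U k z q}" by (auto simp: Y'_def)
  then have "0 < measure (Pl M) {z \<in> Y. leX U k (fst (p, q)) z \<and> leX U k z (snd (p, q))}"
    using pos_q by simp
  also have "\<dots> \<le> (SUP p\<in>Y \<times> Y. measure (Pl M) {z \<in> Y. leX U k (fst p) z \<and> leX U k z (snd p)})"
    using p q by (intro cSUP_upper bdd_aboveI[of _ 1]) (auto simp: Y'_def)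
  finally show "0 < (SUP p\<in>Y \<times> Y. measure (Pl M) {z \<in> Y. leX U k (fst p) z \<and> leX U k z (snd p)})" .
qed

section \<open>Sorting permutations: uniqueness off ties, measurability\<close>

lemma null_sets_ties:
  fixes N :: nat
  shows
  "{x \<in> space (PiM {..<N} (\<lambda>_. Pl M)). \<exists>i<N. \<exists>j<N. i \<noteq> j \<and> snd (x i) = snd (x j)}
    \<in> null_sets (PiM {..<N} (\<lambda>_. Pl M))" (is "?T \<in> null_sets ?P")
proof -
  interpret P: product_sigma_finite "\<lambda>_. Pl M" by standard
  have "{x \<in> space ?P. snd (x i) = snd (x j)} \<in> null_sets ?P" if ij: "i < N" "j < N" "i \<noteq> j" for i j
  proof -
    define J where "J = {..<N} - {i}"
    have J: "finite J" "i \<notin> J" "{..<N} = insert i J" "j \<in> J" using ij by (auto simp: J_def)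
    define T where "T = {x \<in> space ?P. snd (x i) = snd (x j)}"
    have [measurable]: "(\<lambda>x. x i) \<in> measurable ?P (Pl M)" "(\<lambda>x. x j) \<in> measurable ?P (Pl M)"
      using ij by (auto intro!: measurable_component_singleton)
    have T: "T \<in> sets ?P" unfolding T_def by measurable
    have "emeasure ?P T = (\<integral>\<^sup>+x. indicator T x \<partial>PiM (insert i J) (\<lambda>_. Pl M))"
      using T by (simp add: J(3))
    also have "\<dots> = (\<integral>\<^sup>+x. (\<integral>\<^sup>+y. indicator T (x(i := y)) \<partial>Pl M) \<partial>PiM J (\<lambda>_. Pl M))"
      \<comment> \<open>With all coordinates other than \<open>i\<close> fixed, the label of
        \<open>x i\<close> hits the given number \<open>snd (x j)\<close> with probability
        0.\<close>
      using T J by (intro P.product_nn_integral_insert) auto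
    also have "\<dots> \<le> (\<integral>\<^sup>+x. 0 \<partial>PiM J (\<lambda>_. Pl M))"
    proof (rule nn_integral_mono)
      fix x assume "x \<in> space (PiM J (\<lambda>_. Pl M))"
      have "(\<integral>\<^sup>+y. indicator T (x(i := y)) \<partial>Pl M) \<le> (\<integral>\<^sup>+y. indicator {z \<in> space (Pl M). snd z = snd (x j)} y \<partial>Pl M)"
        using J by (intro nn_integral_mono) (auto simp: T_def indicator_def)
      also have "\<dots> = 0"
        using null_sets_snd_Pl[OF prob_space_axioms, of "snd (x j)"]
        by (subst nn_integral_indicator) (auto simp: null_sets_def)
      finally show "(\<integral>\<^sup>+y. indicator T (x(i := y)) \<partial>Pl M) \<le> 0" .
    qed
    finally show ?thesis using T by (intro null_setsI) (auto simp: T_def)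
  qed
  then have "(\<Union>i\<in>{..<N}. \<Union>j\<in>{..<N} - {i}. {x \<in> space ?P. snd (x i) = snd (x j)}) \<in> null_sets ?P"
    by (intro null_sets_UN' countable_finite) auto
  also have "(\<Union>i\<in>{..<N}. \<Union>j\<in>{..<N} - {i}. {x \<in> space ?P. snd (x i) = snd (x j)}) = ?T"
    by auto
  finally show ?thesis .
qed

text \<open>The order condition of \<open>tilde_perm\<close> for one fixed permutation: for each
  \<open>k < m\<close>, position \<open>k\<close> holds a least element, in the order of chain
  \<open>k\<close>, among those not placed earlier. For fixed \<tau> it is a finite conjunction of
  conditions on \<open>x\<close>, and there are finitely many \<tau>.\<close>

definition sorts :: "nat \<Rightarrow> (nat \<Rightarrow> nat) \<Rightarrow> (nat \<Rightarrow> 'xi \<times> real) \<Rightarrow> bool" where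
  "sorts N \<tau> x \<longleftrightarrow> (\<forall>k<m. \<forall>k'\<in>{k..<N}. leX U k (x (\<tau> k)) (x (\<tau> k')))"

text \<open>Permutations that agree before \<open>k\<close> leave the same indices over, so each of
  the two choices at \<open>k\<close> is below the other in order \<open>k\<close>. The labels then
  coincide, and without ties so do the indices.\<close>

lemma sorts_unique:
  assumes "m \<le> N" and \<tau>: "bij_betw \<tau> {..<N} {..<N}" "sorts N \<tau> x"
    and \<tau>': "bij_betw \<tau>' {..<N} {..<N}" "sorts N \<tau>' x"
    and no_ties: "\<And>i j. i < N \<Longrightarrow> j < N \<Longrightarrow> snd (x i) = snd (x j) \<Longrightarrow> i = j"
    and "k < m"
  shows "\<tau> k = \<tau>' k"
  using \<open>k < m\<close>
proof (induction k rule: less_induct)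
  case (less k)
  have le: "leX U k (x (\<rho> k)) (x (\<rho>' k))"
    if \<rho>: "bij_betw \<rho> {..<N} {..<N}" "sorts N \<rho> x" and \<rho>': "bij_betw \<rho>' {..<N} {..<N}"
      and eq: "\<And>j. j < k \<Longrightarrow> \<rho> j = \<rho>' j" for \<rho> \<rho>'
  proof -
    have "\<rho>' k \<in> {..<N}" using bij_betwE[OF \<rho>'] less.prems \<open>m \<le> N\<close> by auto
    then obtain j where j: "j < N" "\<rho> j = \<rho>' k"
      using bij_betw_imp_surj_on[OF \<rho>(1)] by (metis imageE lessThan_iff)
    \<comment> \<open>An earlier \<open>j\<close> would make \<rho>' take the same value at
      \<open>j\<close> and \<open>k\<close>, against injectivity.\<close>
    have "k \<le> j"
    proof (rule ccontr)
      assume "\<not> k \<le> j"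
      then have "\<rho>' j = \<rho>' k" using eq[of j] j by simp
      then have "j = k"
        using bij_betw_imp_inj_on[OF \<rho>'] j(1) less.prems \<open>m \<le> N\<close>
        by (auto simp: inj_on_def)
      then show False using \<open>\<not> k \<le> j\<close> by simp
    qed
    then have "leX U k (x (\<rho> k)) (x (\<rho> j))" using \<rho>(2) less.prems j(1) by (auto simp: sorts_def)
    then show ?thesis using j(2) by simp
  qed
  have "\<tau> j = \<tau>' j" if "j < k" for j using less.IH[OF that] less.prems that by simp
  then have "leX U k (x (\<tau> k)) (x (\<tau>' k))" "leX U k (x (\<tau>' k)) (x (\<tau> k))"
    using le[OF \<tau> \<tau>'(1)] le[OF \<tau>' \<tau>(1)] by auto
  then have "snd (x (\<tau> k)) = snd (x (\<tau>' k))" by (rule leX_antisym_snd)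
  moreover have "\<tau> k < N" "\<tau>' k < N"
    using bij_betwE[OF \<tau>(1)] bij_betwE[OF \<tau>'(1)] less.prems \<open>m \<le> N\<close> by auto
  ultimately show ?case using no_ties by blast
qed

text \<open>The selection \<open>\<sigma>\<close> need not be measurable, but almost surely there are no ties, and then its
  values on \<open>{..<m}\<close> are forced; the completion absorbs the remaining null set.\<close>

lemma sets_PlN_tilde:
  assumes "m \<le> N" and \<sigma>: "tilde_perm M N m U \<sigma>"
    and h: "\<And>\<tau>. \<tau> \<in> {..<N} \<rightarrow> {..<N} \<Longrightarrow> Measurable.pred (PiM {..<N} (\<lambda>_. Pl M)) (h \<tau>)"
    and h_cong: "\<And>\<tau> \<tau>' x. (\<And>k. k < m \<Longrightarrow> \<tau> k = \<tau>' k) \<Longrightarrow> h \<tau> x = h \<tau>' x"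
  shows "{x \<in> space (PlN M N). h (\<sigma> x) x} \<in> sets (PlN M N)"
proof -
  let ?P = "PiM {..<N} (\<lambda>_. Pl M)"
  define T where "T = {x \<in> space ?P. \<exists>i<N. \<exists>j<N. i \<noteq> j \<and> snd (x i) = snd (x j)}"
  have T: "T \<in> null_sets ?P" unfolding T_def by (rule null_sets_ties)
  define B where "B = {\<tau> \<in> {..<N} \<rightarrow>\<^sub>E {..<N}. bij_betw \<tau> {..<N} {..<N}}"
  have "finite ({..<N} \<rightarrow>\<^sub>E {..<N})" by (intro finite_PiE) auto
  then have fin_B: "finite B" by (rule rev_finite_subset) (auto simp: B_def)
  \<comment> \<open>A measurable substitute for the event: some fixed sorting permutation satisfies
    \<open>h\<close>. Off \<open>T\<close> every such permutation agrees with
    \<open>\<sigma> x\<close> below \<open>m\<close>, which is all that \<open>h\<close>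
    sees.\<close>
  define R where "R = (\<Union>\<tau>\<in>B. {x \<in> space ?P. (\<forall>k\<in>{..<m}. \<forall>k'\<in>{k..<N}. leX U k (x (\<tau> k)) (x (\<tau> k'))) \<and> h \<tau> x})"
  have R: "R \<in> sets ?P"
    unfolding R_def
  proof (intro sets.finite_UN fin_B sets.sets_Collect_conj sets.sets_Collect_finite_All finite_lessThan finite_atLeastLessThan)
    fix \<tau> k k' assume "\<tau> \<in> B" "k \<in> {..<m}" "k' \<in> {k..<N}"
    then have "k < m" "\<tau> k < N" "\<tau> k' < N" using \<open>m \<le> N\<close> by (auto simp: B_def PiE_iff Pi_iff)
    then have "Measurable.pred ?P (\<lambda>x. leX U k (x (\<tau> k)) (x (\<tau> k')))"
      by (intro pred_leX measurable_component_singleton) auto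
    then show "{x \<in> space ?P. leX U k (x (\<tau> k)) (x (\<tau> k'))} \<in> sets ?P" by (simp add: pred_def)
  next
    fix \<tau> assume "\<tau> \<in> B"
    then have "Measurable.pred ?P (h \<tau>)" by (intro h) (auto simp: B_def)
    then show "{x \<in> space ?P. h \<tau> x} \<in> sets ?P" by (simp add: pred_def)
  qed
  define A where "A = {x \<in> space (PlN M N). h (\<sigma> x) x}"
  have space: "space (PlN M N) = space ?P" by (simp add: PlN_def)
  have iff: "x \<in> A \<longleftrightarrow> x \<in> R" if x: "x \<in> space ?P" "x \<notin> T" for x
  proof -
    define \<tau> where "\<tau> = restrict (\<sigma> x) {..<N}"
    have \<sigma>x: "bij_betw (\<sigma> x) {..<N} {..<N}" "sorts N (\<sigma> x) x"
      using \<sigma> x(1) by (auto simp: tilde_perm_def space sorts_def)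
    have \<tau>: "bij_betw \<tau> {..<N} {..<N}"
      using \<sigma>x(1) by (subst bij_betw_cong[of _ _ "\<sigma> x"]) (auto simp: \<tau>_def)
    have \<tau>_sorts: "sorts N \<tau> x"
      using \<sigma>x(2) \<open>m \<le> N\<close> by (auto simp: sorts_def \<tau>_def)
    have \<tau>_B: "\<tau> \<in> B" using \<tau> bij_betwE[OF \<sigma>x(1)] by (auto simp: B_def \<tau>_def)
    have h_\<tau>: "h \<tau> x = h (\<sigma> x) x" using \<open>m \<le> N\<close> by (intro h_cong) (auto simp: \<tau>_def)
    show ?thesis
    proof
      assume "x \<in> A"
      then have "h \<tau> x" by (simp add: A_def h_\<tau>)
      then show "x \<in> R" using \<tau>_B \<tau>_sorts x(1) unfolding R_def sorts_def by blast
    next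
      assume "x \<in> R"
      then obtain \<tau>' where \<tau>': "\<tau>' \<in> B" "sorts N \<tau>' x" "h \<tau>' x" unfolding R_def sorts_def by blast
      have "\<tau>' k = \<sigma> x k" if "k < m" for k
        using sorts_unique[OF \<open>m \<le> N\<close> _ \<tau>'(2) \<sigma>x _ that] \<tau>'(1) x by (auto simp: B_def T_def)
      then have "h (\<sigma> x) x" using \<tau>'(3) h_cong by blast
      then show "x \<in> A" using x(1) by (simp add: A_def space)
    qed
  qed
  have A_sub: "A \<subseteq> space ?P" unfolding A_def space by blast
  \<comment> \<open>The two sets differ only inside the null set \<open>T\<close>, and the
    completion measures every subset of it.\<close>
  have A_eq: "A = (R - T) \<union> (A \<inter> T)"
    using iff A_sub sets.sets_into_space[OF R] by blast
  have "R - T \<in> sets (PlN M N)" unfolding PlN_def using R T by (intro sets_completionI_sets sets.Diff R null_setsD2[OF T])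
  moreover have "A \<inter> T \<in> null_sets (PlN M N)"
    unfolding PlN_def by (rule null_sets_completion_subset[OF _ null_sets_completionI[OF T]]) blast
  ultimately have "(R - T) \<union> (A \<inter> T) \<in> sets (PlN M N)" by (rule sets.Un[OF _ null_setsD2])
  then show ?thesis unfolding A_def[symmetric] using A_eq by (rule ssubst[rotated])
qed

lemma A2_holds:
  assumes "m \<le> N" "tilde_perm M N m U \<sigma>"
  shows "A2 M N m U \<sigma>"
  unfolding A2_def borel_measurable_iff_greater
proof (intro ballI allI)
  fix k a assume k: "k \<in> {1..m}"
  let ?P = "PiM {..<N} (\<lambda>_. Pl M)"
  have "{x \<in> space (PlN M N). a < measure (Pl M) {z \<in> space (Pl M). \<exists>j\<in>{..<k}. ltX U j z (x (\<sigma> x j))}} \<in> sets (PlN M N)"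
  proof (rule sets_PlN_tilde[OF assms])
    fix \<tau> :: "nat \<Rightarrow> nat" assume \<tau>: "\<tau> \<in> {..<N} \<rightarrow> {..<N}"
    have "Measurable.pred (?P \<Otimes>\<^sub>M Pl M) (\<lambda>(x, z). \<exists>j\<in>{..<k}. ltX U j z (x (\<tau> j)))"
      unfolding split_beta'
    proof (intro pred_intros_finite finite_lessThan)
      fix j assume "j \<in> {..<k}"
      then have "j < m" "\<tau> j \<in> {..<N}" using k \<tau> \<open>m \<le> N\<close> by auto
      then show "Measurable.pred (?P \<Otimes>\<^sub>M Pl M) (\<lambda>p. ltX U j (snd p) (fst p (\<tau> j)))"
        by (intro pred_ltX) auto
    qed
    then have [measurable]: "(\<lambda>x. measure (Pl M) {z \<in> space (Pl M). \<exists>j\<in>{..<k}. ltX U j z (x (\<tau> j))}) \<in> borel_measurable ?P"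
      by (rule Q.borel_measurable_measure_Collect)
    show "Measurable.pred ?P (\<lambda>x. a < measure (Pl M) {z \<in> space (Pl M). \<exists>j\<in>{..<k}. ltX U j z (x (\<tau> j))})"
      by measurable
  next
    fix \<tau> \<tau>' :: "nat \<Rightarrow> nat" and x :: "nat \<Rightarrow> 'xi \<times> real" assume "\<And>k. k < m \<Longrightarrow> \<tau> k = \<tau>' k"
    then have eq: "\<tau> j = \<tau>' j" if "j < k" for j using that k by auto
    have "(\<exists>j\<in>{..<k}. ltX U j z (x (\<tau> j))) = (\<exists>j\<in>{..<k}. ltX U j z (x (\<tau>' j)))" for z
      by (rule bex_cong) (simp_all add: eq)
    then show "(a < measure (Pl M) {z \<in> space (Pl M). \<exists>j\<in>{..<k}. ltX U j z (x (\<tau> j))}) =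
        (a < measure (Pl M) {z \<in> space (Pl M). \<exists>j\<in>{..<k}. ltX U j z (x (\<tau>' j))})" by (simp only:)
  qed
  then show "{x \<in> space (PlN M N). a < delta M U \<sigma> k x} \<in> sets (PlN M N)"
    by (simp only: delta_def Bex_def lessThan_iff)
qed

lemma A5_holds:
  assumes "m \<le> N" "tilde_perm M N m U \<sigma>"
  shows "A5 M N m U \<sigma>"
  unfolding A5_def
proof
  fix k assume k: "k \<in> {1..m}"
  let ?P = "PiM {..<N} (\<lambda>_. Pl M)"
  have "{x \<in> space (PlN M N). \<forall>j\<in>{..<k}. eqX U j (x j) (x (\<sigma> x j))} \<in> sets (PlN M N)"
  proof (rule sets_PlN_tilde[OF assms])
    fix \<tau> :: "nat \<Rightarrow> nat" assume \<tau>: "\<tau> \<in> {..<N} \<rightarrow> {..<N}"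
    show "Measurable.pred ?P (\<lambda>x. \<forall>j\<in>{..<k}. eqX U j (x j) (x (\<tau> j)))"
    proof (intro pred_intros_finite finite_lessThan)
      fix j assume "j \<in> {..<k}"
      then have "j < m" "j < N" "\<tau> j \<in> {..<N}" using k \<tau> \<open>m \<le> N\<close> by auto
      then show "Measurable.pred ?P (\<lambda>x. eqX U j (x j) (x (\<tau> j)))"
        by (intro pred_eqX measurable_component_singleton) auto
    qed
  next
    fix \<tau> \<tau>' :: "nat \<Rightarrow> nat" and x :: "nat \<Rightarrow> 'xi \<times> real" assume "\<And>k. k < m \<Longrightarrow> \<tau> k = \<tau>' k"
    then have eq: "\<tau> j = \<tau>' j" if "j < k" for j using that k by auto
    show "(\<forall>j\<in>{..<k}. eqX U j (x j) (x (\<tau> j))) = (\<forall>j\<in>{..<k}. eqX U j (x j) (x (\<tau>' j)))"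
      by (rule ball_cong) (simp_all add: eq)
  qed
  then show "{x \<in> space (PlN M N). \<forall>j<k. eqX U j (x j) (x (\<sigma> x j))} \<in> sets (PlN M N)"
    by (simp only: Ball_def lessThan_iff)
qed

end

theorem theorem2p1:
  fixes M :: "'xi measure" and f :: "'xi \<Rightarrow> real^'n \<Rightarrow> ereal"
    and X :: "(real^'n) set" and xstar :: "(nat \<Rightarrow> 'xi) \<Rightarrow> real^'n"
    and U :: "nat \<Rightarrow> 'xi \<Rightarrow> (real^'n) set"
    and N m :: nat and \<alpha> :: real
  assumes "prob_space M"
    and "\<forall>\<xi> x. f \<xi> x \<noteq> -\<infinity>"
    and "1 \<le> N" and "m \<le> N" and "\<alpha> \<in> {0..1}"
    and "\<forall>s \<in> space (Pi\<^sub>M {..<N} (\<lambda>_. M)). xstar s \<in> X \<and> SAA f N s (xstar s) < \<infinity>"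
    and "chain_constrained M f m U"
  shows "(\<forall>\<sigma>. tilde_perm M N m U \<sigma> \<longrightarrow>
           sigma_contains M m U \<and> A1 M N m U \<and> A2 M N m U \<sigma> \<and> A3 M m U \<and> A4 M m U \<and> A5 M N m U \<sigma> \<longrightarrow>
           measure (PN M N) {s \<in> space (PN M N). frakD M m U N s < 1 - \<alpha>}
             \<le> (\<Sum>k<m. real (N choose k) * \<alpha> ^ k * (1 - \<alpha>) ^ (N - k)) \<and>
           outer_prob (PN M N) {s \<in> space (PN M N). d_feas M f (xstar s) < 1 - \<alpha>}
             \<le> outer_prob (PN M N) {s \<in> space (PN M N). D_feas M f N s < 1 - \<alpha>} \<and>
           outer_prob (PN M N) {s \<in> space (PN M N). D_feas M f N s < 1 - \<alpha>}
             \<le> (\<Sum>k<m. real (N choose k) * \<alpha> ^ k * (1 - \<alpha>) ^ (N - k))) \<and>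
         (\<forall>(c :: nat \<Rightarrow> real^'n \<Rightarrow> real) (l :: nat \<Rightarrow> 'xi \<Rightarrow> real).
           (\<forall>k<m. l k \<in> borel_measurable M) \<and>
           (\<forall>k<m. \<forall>\<xi>\<in>space M. U k \<xi> = {x. c k x \<le> l k \<xi>}) \<longrightarrow>
           sigma_contains M m U \<and> A1 M N m U \<and> A3 M m U \<and> A4 M m U \<and>
           (\<forall>\<sigma>. tilde_perm M N m U \<sigma> \<longrightarrow> A2 M N m U \<sigma> \<and> A5 M N m U \<sigma>))"
proof (intro conjI allI impI; (elim conjE)?)
  interpret prob_space M by fact
  have f: "\<And>\<xi> x. f \<xi> x \<noteq> -\<infinity>" using assms(2) by blast
  have chain: "U k a \<subseteq> U k b \<or> U k b \<subseteq> U k a" if "k < m" "a \<in> space M" "b \<in> space M" for k a b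
    using assms(7) that by (simp add: chain_constrained_def)
  have PN_space: "space (PN M N) = space (PiM {..<N} (\<lambda>_. M))" by (simp add: PN_def)
  {
    fix \<sigma> assume sigma: "sigma_contains M m U" and A: "A1 M N m U" "A3 M m U" "A4 M m U"
    interpret chain_family M m U
      by unfold_locales (use chain sigma in auto)
    let ?bound = "\<Sum>k<m. real (N choose k) * \<alpha> ^ k * (1 - \<alpha>) ^ (N - k)"
    show frakD: "measure (PN M N) {s \<in> space (PN M N). frakD M m U N s < 1 - \<alpha>} \<le> ?bound"
      using A assms(3-5) by (rule measure_frakD_less)
    show "outer_prob (PN M N) {s \<in> space (PN M N). d_feas M f (xstar s) < 1 - \<alpha>}
             \<le> outer_prob (PN M N) {s \<in> space (PN M N). D_feas M f N s < 1 - \<alpha>}"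
    proof (rule outer_prob_mono)
      have "D_feas M f N s \<le> d_feas M f (xstar s)" if "s \<in> space (PN M N)" for s
        by (rule d_feas_ge_D_feas[OF f assms(3)]) (use assms(6) that PN_space in auto)
      then show "{s \<in> space (PN M N). d_feas M f (xstar s) < 1 - \<alpha>} \<subseteq> {s \<in> space (PN M N). D_feas M f N s < 1 - \<alpha>}"
        by (auto intro: le_less_trans)
    qed auto
    \<comment> \<open>The event for \<open>D_feas\<close> need not be measurable; the event for
      \<open>frakD\<close>, measurable by (A1), serves as a cover.\<close>
    have "outer_prob (PN M N) {s \<in> space (PN M N). D_feas M f N s < 1 - \<alpha>}
        \<le> measure (PN M N) {s \<in> space (PN M N). frakD M m U N s < 1 - \<alpha>}"
    proof (rule outer_prob_le)
      show "{s \<in> space (PN M N). frakD M m U N s < 1 - \<alpha>} \<in> sets (PN M N)"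
        using A(1) unfolding A1_def by measurable
      have "frakD M m U N s \<le> D_feas M f N s" if "s \<in> space (PN M N)" for s
        by (rule frakD_le_D_feas[OF finite_measure_axioms assms(7)]) (use that PN_space in \<open>auto simp: space_PiM\<close>)
      then show "{s \<in> space (PN M N). D_feas M f N s < 1 - \<alpha>} \<subseteq> {s \<in> space (PN M N). frakD M m U N s < 1 - \<alpha>}"
        by (auto intro: le_less_trans)
    qed
    also note frakD
    finally show "outer_prob (PN M N) {s \<in> space (PN M N). D_feas M f N s < 1 - \<alpha>} \<le> ?bound" .
  next
    fix c :: "nat \<Rightarrow> real^'n \<Rightarrow> real" and l :: "nat \<Rightarrow> 'xi \<Rightarrow> real"
    assume l: "\<forall>k<m. l k \<in> borel_measurable M"
      and U: "\<forall>k<m. \<forall>\<xi>\<in>space M. U k \<xi> = {x. c k x \<le> l k \<xi>}"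
    have pred: "Measurable.pred (M \<Otimes>\<^sub>M M) (\<lambda>p. U k (fst p) \<subseteq> U k (snd p))" if "k < m" for k
      using l U that by (intro pred_sublevel_subset[of "l k" M "U k" "c k"]) auto
    \<comment> \<open>Sections of the jointly measurable inclusion relation, with either argument
      fixed.\<close>
    have sets_sub: "{y \<in> space M. U k y \<subseteq> U k x} \<in> sets M" "{y \<in> space M. U k x \<subseteq> U k y} \<in> sets M"
      if "k < m" "x \<in> space M" for k x
      using measurable_compose[OF _ pred[OF that(1)], of "\<lambda>y. (y, x)" M]
        measurable_compose[OF _ pred[OF that(1)], of "\<lambda>y. (x, y)" M] that(2)
      by (simp_all add: pred_def)
    have sigma: "sigma_contains M m U"
    proof -
      have "{y \<in> space M. U k y = U k x} \<in> sets M" if "k < m" "x \<in> space M" for k x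
      proof -
        have "{y \<in> space M. U k y = U k x} = {y \<in> space M. U k y \<subseteq> U k x} \<inter> {y \<in> space M. U k x \<subseteq> U k y}"
          by auto
        then show ?thesis using sets_sub[OF that] by simp
      qed
      then show ?thesis using sets_sub by (simp add: sigma_contains_def)
    qed
    interpret measurable_chain_family M m U
      by unfold_locales (use chain sigma pred in auto)
    show "sigma_contains M m U" by (rule sigma)
    show "A1 M N m U" using assms(3) by (rule A1_holds)
    show "A3 M m U" by (rule A3_holds)
    show "A4 M m U" by (rule A4_holds)
    fix \<sigma> assume "tilde_perm M N m U \<sigma>"
    with assms(4) show "A2 M N m U \<sigma>" "A5 M N m U \<sigma>" by (rule A2_holds A5_holds)+
  }
qed

end
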